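(* Let $(S,\bullet)$ be a finite semigroup. Then $\mathsf{RCA}_0$ proves: for every additive colouring $C:\binom{\mathbb N}{2}\to S$ there exist $a\in S$ and an infinite set $I\subseteq\mathbb N$ that is an $a$-clique under $C$.
   Context: $\mathsf{RCA}_0$: second-order arithmetic with $\Delta^0_1$-comprehension and $\Sigma^0_1$-induction. $\binom{\mathbb N}{2}$ is the set of pairs $(i,j)$ of natural numbers with $i<j$. A colouring $C:\binom{\mathbb N}{2}\to S$ is additive if $C(i,j)\bullet C(j,k)=C(i,k)$ whenever $i<j<k$. A set $I\subseteq\mathbb N$ is an $a$-clique under $C$ if $C(i,j)=a$ for all $i,j\in I$ with $i<j$. The semigroup $S$ is fixed externally (the quantification over finite semigroups is in the metatheory, one theorem of $\mathsf{RCA}_0$ for each $S$). *)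

theory Defs
  imports Main
begin

section \<open>The language of second-order arithmetic\<close>

text \<open>Two-sorted first-order language with number variables and set variables, each sort with its
  own de Bruijn indices. \<open>AllN\<close> binds number variable 0 and \<open>AllS\<close> binds set variable 0.
  Equality is a primitive only for numbers; for sets it is extensional.\<close>

datatype tm =
    Var nat
  | Zero ("\<^bold>0")
  | One ("\<^bold>1")
  | Add tm tm (infixl "\<^bold>+" 80)
  | Mul tm tm (infixl "\<^bold>*" 85)

datatype fm =
    Eq tm tm (infix "\<^bold>=" 75)
  | Less tm tm (infix "\<^bold><" 75)
  | Mem tm nat (infix "\<^bold>\<in>" 75)
  | Falsum ("\<^bold>\<bottom>")
  | Imp fm fm (infixr "\<^bold>\<longrightarrow>" 55)
  | AllN fm
  | AllS fm

definition Neg :: "fm \<Rightarrow> fm" ("\<^bold>\<not> _" [70] 70) where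
  "\<^bold>\<not> p = (p \<^bold>\<longrightarrow> \<^bold>\<bottom>)"

definition Con :: "fm \<Rightarrow> fm \<Rightarrow> fm" (infixr "\<^bold>\<and>" 65) where
  "p \<^bold>\<and> q = (\<^bold>\<not> (p \<^bold>\<longrightarrow> \<^bold>\<not> q))"

definition Dis :: "fm \<Rightarrow> fm \<Rightarrow> fm" (infixr "\<^bold>\<or>" 60) where
  "p \<^bold>\<or> q = (\<^bold>\<not> p \<^bold>\<longrightarrow> q)"

definition Iff :: "fm \<Rightarrow> fm \<Rightarrow> fm" (infix "\<^bold>\<longleftrightarrow>" 50) where
  "(p \<^bold>\<longleftrightarrow> q) = ((p \<^bold>\<longrightarrow> q) \<^bold>\<and> (q \<^bold>\<longrightarrow> p))"

definition ExN :: "fm \<Rightarrow> fm" where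
  "ExN p = (\<^bold>\<not> AllN (\<^bold>\<not> p))"

definition ExS :: "fm \<Rightarrow> fm" where
  "ExS p = (\<^bold>\<not> AllS (\<^bold>\<not> p))"

definition Conj :: "fm list \<Rightarrow> fm" where
  "Conj ps = foldr Con ps (\<^bold>\<not> \<^bold>\<bottom>)"

definition Disj :: "fm list \<Rightarrow> fm" where
  "Disj ps = foldr Dis ps \<^bold>\<bottom>"


section \<open>Substitution\<close>

primrec subst_tm :: "(nat \<Rightarrow> tm) \<Rightarrow> tm \<Rightarrow> tm" where
  "subst_tm \<sigma> (Var n) = \<sigma> n"
| "subst_tm \<sigma> \<^bold>0 = \<^bold>0"
| "subst_tm \<sigma> \<^bold>1 = \<^bold>1"
| "subst_tm \<sigma> (t \<^bold>+ u) = subst_tm \<sigma> t \<^bold>+ subst_tm \<sigma> u"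
| "subst_tm \<sigma> (t \<^bold>* u) = subst_tm \<sigma> t \<^bold>* subst_tm \<sigma> u"

definition lift_tm :: "tm \<Rightarrow> tm" where
  "lift_tm = subst_tm (\<lambda>n. Var (Suc n))"

definition up :: "(nat \<Rightarrow> tm) \<Rightarrow> nat \<Rightarrow> tm" where
  "up \<sigma> = case_nat (Var 0) (\<lambda>n. lift_tm (\<sigma> n))"

text \<open>Simultaneous capture-avoiding substitution of terms for the free number variables.\<close>

primrec subst :: "(nat \<Rightarrow> tm) \<Rightarrow> fm \<Rightarrow> fm" where
  "subst \<sigma> (t \<^bold>= u) = (subst_tm \<sigma> t \<^bold>= subst_tm \<sigma> u)"
| "subst \<sigma> (t \<^bold>< u) = (subst_tm \<sigma> t \<^bold>< subst_tm \<sigma> u)"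
| "subst \<sigma> (t \<^bold>\<in> X) = (subst_tm \<sigma> t \<^bold>\<in> X)"
| "subst \<sigma> \<^bold>\<bottom> = \<^bold>\<bottom>"
| "subst \<sigma> (p \<^bold>\<longrightarrow> q) = (subst \<sigma> p \<^bold>\<longrightarrow> subst \<sigma> q)"
| "subst \<sigma> (AllN p) = AllN (subst (up \<sigma>) p)"
| "subst \<sigma> (AllS p) = AllS (subst \<sigma> p)"

definition upS :: "(nat \<Rightarrow> nat) \<Rightarrow> nat \<Rightarrow> nat" where
  "upS \<rho> = case_nat 0 (\<lambda>n. Suc (\<rho> n))"

text \<open>Simultaneous capture-avoiding renaming of the free set variables; the language has no set
  terms other than variables.\<close>

primrec substS :: "(nat \<Rightarrow> nat) \<Rightarrow> fm \<Rightarrow> fm" where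
  "substS \<rho> (t \<^bold>= u) = (t \<^bold>= u)"
| "substS \<rho> (t \<^bold>< u) = (t \<^bold>< u)"
| "substS \<rho> (t \<^bold>\<in> X) = (t \<^bold>\<in> \<rho> X)"
| "substS \<rho> \<^bold>\<bottom> = \<^bold>\<bottom>"
| "substS \<rho> (p \<^bold>\<longrightarrow> q) = (substS \<rho> p \<^bold>\<longrightarrow> substS \<rho> q)"
| "substS \<rho> (AllN p) = AllN (substS \<rho> p)"
| "substS \<rho> (AllS p) = AllS (substS (upS \<rho>) p)"

definition lift :: "fm \<Rightarrow> fm" where
  "lift = subst (\<lambda>n. Var (Suc n))"

definition liftS :: "fm \<Rightarrow> fm" where
  "liftS = substS Suc"

text \<open>\<open>inst t p\<close> and \<open>instS X p\<close> are the instances of \<open>AllN p\<close> and \<open>AllS p\<close> at \<open>t\<close> and \<open>X\<close>.\<close>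

definition inst :: "tm \<Rightarrow> fm \<Rightarrow> fm" where
  "inst t = subst (case_nat t Var)"

definition instS :: "nat \<Rightarrow> fm \<Rightarrow> fm" where
  "instS X = substS (case_nat X (\<lambda>n. n))"


section \<open>Classical natural deduction\<close>

text \<open>\<open>T \<triangleright> G \<turnstile> p\<close>: the formula \<open>p\<close> is derivable from the hypotheses \<open>G\<close> in the theory \<open>T\<close>.
  Free variables are parameters (held fixed) in \<open>G\<close> but are implicitly universally
  quantified in \<open>T\<close>: the eigenvariable conditions of \<open>AllN_I\<close> and \<open>AllS_I\<close>, expressed by
  lifting the hypotheses, do not concern \<open>T\<close>.\<close>

inductive nd :: "fm set \<Rightarrow> fm list \<Rightarrow> fm \<Rightarrow> bool" ("_ \<triangleright> _ \<turnstile> _" [51, 51, 51] 50) for T where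
  Axiom: "p \<in> T \<Longrightarrow> T \<triangleright> G \<turnstile> p"
| Hyp: "p \<in> set G \<Longrightarrow> T \<triangleright> G \<turnstile> p"
| Imp_I: "T \<triangleright> p # G \<turnstile> q \<Longrightarrow> T \<triangleright> G \<turnstile> p \<^bold>\<longrightarrow> q"
| Imp_E: "T \<triangleright> G \<turnstile> p \<^bold>\<longrightarrow> q \<Longrightarrow> T \<triangleright> G \<turnstile> p \<Longrightarrow> T \<triangleright> G \<turnstile> q"
| Classical: "T \<triangleright> (\<^bold>\<not> p) # G \<turnstile> \<^bold>\<bottom> \<Longrightarrow> T \<triangleright> G \<turnstile> p"
| AllN_I: "T \<triangleright> map lift G \<turnstile> p \<Longrightarrow> T \<triangleright> G \<turnstile> AllN p"
| AllN_E: "T \<triangleright> G \<turnstile> AllN p \<Longrightarrow> T \<triangleright> G \<turnstile> inst t p"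
| AllS_I: "T \<triangleright> map liftS G \<turnstile> p \<Longrightarrow> T \<triangleright> G \<turnstile> AllS p"
| AllS_E: "T \<triangleright> G \<turnstile> AllS p \<Longrightarrow> T \<triangleright> G \<turnstile> instS X p"
| Eq_refl: "T \<triangleright> G \<turnstile> t \<^bold>= t"
| Eq_subst: "T \<triangleright> G \<turnstile> t \<^bold>= u \<Longrightarrow> T \<triangleright> G \<turnstile> inst t p \<Longrightarrow> T \<triangleright> G \<turnstile> inst u p"

definition provable :: "fm set \<Rightarrow> fm \<Rightarrow> bool" (infix "\<turnstile>" 50) where
  "T \<turnstile> p \<longleftrightarrow> (T \<triangleright> [] \<turnstile> p)"


section \<open>The theory RCA0\<close>

text \<open>Bounded quantifiers: the bound \<open>t\<close> does not contain the quantified variable.\<close>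

definition AllB :: "tm \<Rightarrow> fm \<Rightarrow> fm" where
  "AllB t p = AllN (Var 0 \<^bold>< lift_tm t \<^bold>\<longrightarrow> p)"

definition ExB :: "tm \<Rightarrow> fm \<Rightarrow> fm" where
  "ExB t p = ExN (Var 0 \<^bold>< lift_tm t \<^bold>\<and> p)"

text \<open>Free set variables are allowed as parameters, set quantifiers are not.\<close>

inductive_set Delta00 :: "fm set" where
  "(t \<^bold>= u) \<in> Delta00"
| "(t \<^bold>< u) \<in> Delta00"
| "(t \<^bold>\<in> X) \<in> Delta00"
| "\<^bold>\<bottom> \<in> Delta00"
| "p \<in> Delta00 \<Longrightarrow> q \<in> Delta00 \<Longrightarrow> (p \<^bold>\<longrightarrow> q) \<in> Delta00"
| "p \<in> Delta00 \<Longrightarrow> AllB t p \<in> Delta00"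
| "p \<in> Delta00 \<Longrightarrow> ExB t p \<in> Delta00"

definition Sigma01 :: "fm set" where
  "Sigma01 = {ExN p | p. p \<in> Delta00}"

definition Pi01 :: "fm set" where
  "Pi01 = {AllN p | p. p \<in> Delta00}"

definition basic_axioms :: "fm set" where
  "basic_axioms = (let m = Var 0; n = Var 1 in
    {\<^bold>\<not> (n \<^bold>+ \<^bold>1 \<^bold>= \<^bold>0),
     m \<^bold>+ \<^bold>1 \<^bold>= n \<^bold>+ \<^bold>1 \<^bold>\<longrightarrow> m \<^bold>= n,
     m \<^bold>+ \<^bold>0 \<^bold>= m,
     m \<^bold>+ (n \<^bold>+ \<^bold>1) \<^bold>= (m \<^bold>+ n) \<^bold>+ \<^bold>1,
     m \<^bold>* \<^bold>0 \<^bold>= \<^bold>0,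
     m \<^bold>* (n \<^bold>+ \<^bold>1) \<^bold>= (m \<^bold>* n) \<^bold>+ m,
     \<^bold>\<not> (m \<^bold>< \<^bold>0),
     m \<^bold>< n \<^bold>+ \<^bold>1 \<^bold>\<longleftrightarrow> m \<^bold>< n \<^bold>\<or> m \<^bold>= n})"

text \<open>In the next two schemes number variable 0 of \<open>p\<close> (and \<open>q\<close>) is the induction or
  comprehension variable and all other free variables are parameters.\<close>

definition succ_inst :: "fm \<Rightarrow> fm" where
  "succ_inst = subst (case_nat (Var 0 \<^bold>+ \<^bold>1) (\<lambda>n. Var (Suc n)))"

definition induction_axiom :: "fm \<Rightarrow> fm" where
  "induction_axiom p = (inst \<^bold>0 p \<^bold>\<and> AllN (p \<^bold>\<longrightarrow> succ_inst p) \<^bold>\<longrightarrow> AllN p)"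

definition comprehension_axiom :: "fm \<Rightarrow> fm \<Rightarrow> fm" where
  "comprehension_axiom p q =
    (AllN (p \<^bold>\<longleftrightarrow> q) \<^bold>\<longrightarrow> ExS (AllN (Var 0 \<^bold>\<in> 0 \<^bold>\<longleftrightarrow> liftS p)))"

definition RCA0 :: "fm set" where
  "RCA0 = basic_axioms
     \<union> {induction_axiom p | p. p \<in> Sigma01}
     \<union> {comprehension_axiom p q | p q. p \<in> Sigma01 \<and> q \<in> Pi01}"


section \<open>Additive colourings and cliques in second-order arithmetic\<close>

text \<open>The finite semigroup is given externally by its multiplication \<open>f\<close> and an enumeration \<open>xs\<close>
  of its elements without repetitions; the element \<open>xs ! p\<close> is represented in the formal language
  by the numeral \<open>p\<close>, so the semigroup itself by the set of numbers below \<open>length xs\<close>.\<close>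

primrec num :: "nat \<Rightarrow> tm" where
  "num 0 = \<^bold>0"
| "num (Suc n) = num n \<^bold>+ \<^bold>1"

definition in_S :: "'a list \<Rightarrow> tm \<Rightarrow> fm" where
  "in_S xs s = Disj [s \<^bold>= num p. p \<leftarrow> [0..<length xs]]"

text \<open>The usual injective pairing \<open>(x + y)\<^sup>2 + x\<close>; functions are coded by their graphs.\<close>

definition pair :: "tm \<Rightarrow> tm \<Rightarrow> tm" where
  "pair t u = (t \<^bold>+ u) \<^bold>* (t \<^bold>+ u) \<^bold>+ t"

definition colour :: "nat \<Rightarrow> tm \<Rightarrow> tm \<Rightarrow> tm \<Rightarrow> fm" where
  "colour C i j s = (pair (pair i j) s \<^bold>\<in> C)"

text \<open>The set \<open>C\<close> is (the graph of) a function from pairs \<open>i < j\<close> to the semigroup: every element of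
  \<open>C\<close> is of the form \<open>((i, j), s)\<close> with \<open>i < j\<close> and \<open>s\<close> in the semigroup, and for all \<open>i < j\<close>
  there is exactly one such \<open>s\<close>.\<close>

definition is_colouring :: "'a list \<Rightarrow> nat \<Rightarrow> fm" where
  "is_colouring xs C =
    AllN (Var 0 \<^bold>\<in> C \<^bold>\<longrightarrow>
      ExN (ExN (ExN (let c = Var 3; i = Var 2; j = Var 1; s = Var 0 in
        i \<^bold>< j \<^bold>\<and> in_S xs s \<^bold>\<and> c \<^bold>= pair (pair i j) s))))
    \<^bold>\<and>
    AllN (AllN (Var 1 \<^bold>< Var 0 \<^bold>\<longrightarrow>
      ExN ((let i = Var 2; j = Var 1; s = Var 0 in in_S xs s \<^bold>\<and> colour C i j s) \<^bold>\<and>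
        AllN (let i = Var 3; j = Var 2; s = Var 1; s' = Var 0 in
          in_S xs s' \<^bold>\<and> colour C i j s' \<^bold>\<longrightarrow> s' \<^bold>= s))))"

text \<open>The multiplication table of the semigroup enters as a finite conjunction.\<close>

definition is_additive :: "('a \<Rightarrow> 'a \<Rightarrow> 'a) \<Rightarrow> 'a list \<Rightarrow> nat \<Rightarrow> fm" where
  "is_additive f xs C =
    AllN (AllN (AllN (let i = Var 2; j = Var 1; k = Var 0 in
      i \<^bold>< j \<^bold>\<and> j \<^bold>< k \<^bold>\<longrightarrow>
        Conj [colour C i j (num p) \<^bold>\<and> colour C j k (num q) \<^bold>\<longrightarrow> colour C i k (num r).
          p \<leftarrow> [0..<length xs], q \<leftarrow> [0..<length xs], r \<leftarrow> [0..<length xs],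
          f (xs ! p) (xs ! q) = xs ! r])))"

definition is_infinite :: "nat \<Rightarrow> fm" where
  "is_infinite I = AllN (ExN (Var 1 \<^bold>< Var 0 \<^bold>\<and> Var 0 \<^bold>\<in> I))"

definition is_clique :: "nat \<Rightarrow> tm \<Rightarrow> nat \<Rightarrow> fm" where
  "is_clique C a I =
    AllN (AllN (let i = Var 1; j = Var 0 in
      i \<^bold>\<in> I \<^bold>\<and> j \<^bold>\<in> I \<^bold>\<and> i \<^bold>< j \<^bold>\<longrightarrow> colour C i j (lift_tm (lift_tm a))))"

text \<open>Under the inner set quantifier, the colouring is set variable 1 and the clique set variable 0.\<close>

definition additive_ramsey :: "('a \<Rightarrow> 'a \<Rightarrow> 'a) \<Rightarrow> 'a list \<Rightarrow> fm" where
  "additive_ramsey f xs =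
    AllS (is_colouring xs 0 \<^bold>\<and> is_additive f xs 0 \<^bold>\<longrightarrow>
      ExN (in_S xs (Var 0) \<^bold>\<and> ExS (is_infinite 0 \<^bold>\<and> is_clique 1 (Var 0) 0)))"

end

theory Submission
  imports Defs "HOL-Library.Countable_Set"
begin

text \<open>By the completeness theorem (Henkin term models, with variables as witnesses) it suffices to
  argue inside an arbitrary, possibly nonstandard, model of RCA0. For an additive colouring \<open>c\<close> let
  \<open>i \<sim> j\<close> mean that \<open>c i k = c j k\<close> for some, equivalently all large, \<open>k\<close>. There are at most
  \<open>|S|\<close> classes, so some class, say that of \<open>r\<close>, is unbounded, and some colour \<open>p\<close> is taken by
  \<open>c r i\<close> for unboundedly many \<open>i\<close> in it; these \<open>i\<close> form a set \<open>X\<close>. Membership in the class of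
  \<open>r\<close> is \<open>\<Sigma>\<close>, and so is its negation, being equivalence to one of the other finitely many
  representatives; hence \<open>X\<close> exists by comprehension. If \<open>i \<in> X\<close> then \<open>c i x = c r x = p\<close> for all
  large \<open>x \<in> X\<close>, and therefore \<open>p \<bullet> p = p\<close>. So a finite \<open>p\<close>-clique in \<open>X\<close> with maximum \<open>y\<close> is
  extended by every large \<open>x \<in> X\<close>, because \<open>c z x = c z y \<bullet> c y x = p\<close>, and the greedy \<open>p\<close>-clique
  in \<open>X\<close> is infinite. It is a set by comprehension, as its finite initial segments can be
  coded by numbers.\<close>

section \<open>Substitution\<close>

lemma subst_tm_comp: "subst_tm \<sigma> (subst_tm \<tau> t) = subst_tm (\<lambda>n. subst_tm \<sigma> (\<tau> n)) t"
  by (induction t) auto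

lemma up_comp: "up (\<lambda>n. subst_tm \<sigma> (\<tau> n)) = (\<lambda>n. subst_tm (up \<sigma>) (up \<tau> n))"
  by (auto simp: up_def lift_tm_def subst_tm_comp fun_eq_iff split: nat.split)

lemma subst_comp: "subst \<sigma> (subst \<tau> p) = subst (\<lambda>n. subst_tm \<sigma> (\<tau> n)) p"
  by (induction p arbitrary: \<sigma> \<tau>) (auto simp: subst_tm_comp up_comp)

lemma subst_tm_Var [simp]: "subst_tm Var t = t"
  by (induction t) auto

lemma up_Var [simp]: "up Var = Var"
  by (auto simp: up_def lift_tm_def fun_eq_iff split: nat.split)

lemma subst_Var [simp]: "subst Var p = p"
  by (induction p) auto

lemma upS_comp: "upS (\<lambda>n. \<rho> (\<pi> n)) = (\<lambda>n. upS \<rho> (upS \<pi> n))"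
  by (auto simp: upS_def fun_eq_iff split: nat.split)

lemma substS_comp: "substS \<rho> (substS \<pi> p) = substS (\<lambda>n. \<rho> (\<pi> n)) p"
  by (induction p arbitrary: \<rho> \<pi>) (auto simp: upS_comp)

lemma upS_id [simp]: "upS (\<lambda>n. n) = (\<lambda>n. n)"
  by (auto simp: upS_def fun_eq_iff split: nat.split)

lemma substS_id [simp]: "substS (\<lambda>n. n) p = p"
  by (induction p) auto

lemma subst_substS: "subst \<sigma> (substS \<rho> p) = substS \<rho> (subst \<sigma> p)"
  by (induction p arbitrary: \<sigma> \<rho>) auto

lemma subst_inst: "subst \<sigma> (inst t p) = inst (subst_tm \<sigma> t) (subst (up \<sigma>) p)"
  unfolding inst_def subst_comp
  by (rule arg_cong[where f="\<lambda>s. subst s p"])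
     (auto simp: fun_eq_iff up_def lift_tm_def subst_tm_comp split: nat.split)

lemma subst_lift: "subst (up \<sigma>) (lift p) = lift (subst \<sigma> p)"
  by (simp add: lift_def subst_comp up_def lift_tm_def)

lemma substS_instS: "substS \<rho> (instS X p) = instS (\<rho> X) (substS (upS \<rho>) p)"
  unfolding instS_def substS_comp
  by (rule arg_cong[where f="\<lambda>s. substS s p"])
     (auto simp: fun_eq_iff upS_def split: nat.split)

lemma substS_liftS: "substS (upS \<rho>) (liftS p) = liftS (substS \<rho> p)"
  by (simp add: liftS_def substS_comp upS_def)

section \<open>Bounds on free variables and universal closures\<close>

definition closed :: "fm \<Rightarrow> bool" where
  "closed p \<longleftrightarrow> (\<forall>\<sigma>. subst \<sigma> p = p) \<and> (\<forall>\<rho>. substS \<rho> p = p)"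

text \<open>Comparing substitutions that agree below \<open>n\<close> bounds the free number
  variables without a separate notion of free variable.\<close>

definition bndN :: "nat \<Rightarrow> fm \<Rightarrow> bool" where
  "bndN n p \<longleftrightarrow> (\<forall>\<sigma> \<tau>. (\<forall>i<n. \<sigma> i = \<tau> i) \<longrightarrow> subst \<sigma> p = subst \<tau> p)"

definition bndS :: "nat \<Rightarrow> fm \<Rightarrow> bool" where
  "bndS n p \<longleftrightarrow> (\<forall>\<sigma> \<tau>. (\<forall>i<n. \<sigma> i = \<tau> i) \<longrightarrow> substS \<sigma> p = substS \<tau> p)"

lemma bndN_D: "bndN n p \<Longrightarrow> (\<And>i. i < n \<Longrightarrow> \<sigma> i = \<tau> i) \<Longrightarrow> subst \<sigma> p = subst \<tau> p"
  unfolding bndN_def by blast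

lemma bndS_D: "bndS n p \<Longrightarrow> (\<And>i. i < n \<Longrightarrow> \<sigma> i = \<tau> i) \<Longrightarrow> substS \<sigma> p = substS \<tau> p"
  unfolding bndS_def by blast

lemma bndN_mono: "bndN n p \<Longrightarrow> n \<le> m \<Longrightarrow> bndN m p"
  unfolding bndN_def by (meson order_less_le_trans)

lemma bndS_mono: "bndS n p \<Longrightarrow> n \<le> m \<Longrightarrow> bndS m p"
  unfolding bndS_def by (meson order_less_le_trans)

lemma up_agree: "\<forall>i<n - 1. \<sigma> i = \<tau> i \<Longrightarrow> i < n \<Longrightarrow> up \<sigma> i = up \<tau> i"
  by (auto simp: up_def split: nat.split)

lemma upS_agree: "\<forall>i<n - 1. \<sigma> i = \<tau> i \<Longrightarrow> i < n \<Longrightarrow> upS \<sigma> i = upS \<tau> i"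
  by (auto simp: upS_def split: nat.split)

text \<open>A binder lowers every other index by one, hence also the bound. Truncation at
  \<open>n = 0\<close> is sound: a formula that ignores all substitutions still does so under a
  quantifier.\<close>

lemma bndN_AllN: "bndN n p \<Longrightarrow> bndN (n - 1) (AllN p)"
  unfolding bndN_def by (simp add: up_agree)

lemma bndN_AllS: "bndN n p \<Longrightarrow> bndN n (AllS p)"
  unfolding bndN_def by simp

lemma bndS_AllS: "bndS n p \<Longrightarrow> bndS (n - 1) (AllS p)"
  unfolding bndS_def by (simp add: upS_agree)

lemma bndS_AllN: "bndS n p \<Longrightarrow> bndS n (AllN p)"
  unfolding bndS_def by simp

lemma tm_bnd: "\<exists>n. \<forall>\<sigma> \<tau>. (\<forall>i<n. \<sigma> i = \<tau> i) \<longrightarrow> subst_tm \<sigma> t = subst_tm \<tau> t"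
proof (induction t)
  case (Var x)
  then show ?case by (intro exI[of _ "Suc x"]) auto
next
  case (Add t u)
  then obtain m n where
    "\<forall>\<sigma> \<tau>. (\<forall>i<m. \<sigma> i = \<tau> i) \<longrightarrow> subst_tm \<sigma> t = subst_tm \<tau> t"
    "\<forall>\<sigma> \<tau>. (\<forall>i<n. \<sigma> i = \<tau> i) \<longrightarrow> subst_tm \<sigma> u = subst_tm \<tau> u" by blast
  then have "\<forall>\<sigma> \<tau>. (\<forall>i<max m n. \<sigma> i = \<tau> i) \<longrightarrow> subst_tm \<sigma> (t \<^bold>+ u) = subst_tm \<tau> (t \<^bold>+ u)" by simp
  then show ?case ..
next
  case (Mul t u)
  then obtain m n where
    "\<forall>\<sigma> \<tau>. (\<forall>i<m. \<sigma> i = \<tau> i) \<longrightarrow> subst_tm \<sigma> t = subst_tm \<tau> t"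
    "\<forall>\<sigma> \<tau>. (\<forall>i<n. \<sigma> i = \<tau> i) \<longrightarrow> subst_tm \<sigma> u = subst_tm \<tau> u" by blast
  then have "\<forall>\<sigma> \<tau>. (\<forall>i<max m n. \<sigma> i = \<tau> i) \<longrightarrow> subst_tm \<sigma> (t \<^bold>* u) = subst_tm \<tau> (t \<^bold>* u)" by simp
  then show ?case ..
qed auto

lemma ex_bndN: "\<exists>n. bndN n p"
proof (induction p)
  case (Eq t u)
  obtain m n where
    "\<forall>\<sigma> \<tau>. (\<forall>i<m. \<sigma> i = \<tau> i) \<longrightarrow> subst_tm \<sigma> t = subst_tm \<tau> t"
    "\<forall>\<sigma> \<tau>. (\<forall>i<n. \<sigma> i = \<tau> i) \<longrightarrow> subst_tm \<sigma> u = subst_tm \<tau> u" using tm_bnd[of t] tm_bnd[of u] by blast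
  then have "bndN (max m n) (t \<^bold>= u)" unfolding bndN_def by simp
  then show ?case ..
next
  case (Less t u)
  obtain m n where
    "\<forall>\<sigma> \<tau>. (\<forall>i<m. \<sigma> i = \<tau> i) \<longrightarrow> subst_tm \<sigma> t = subst_tm \<tau> t"
    "\<forall>\<sigma> \<tau>. (\<forall>i<n. \<sigma> i = \<tau> i) \<longrightarrow> subst_tm \<sigma> u = subst_tm \<tau> u" using tm_bnd[of t] tm_bnd[of u] by blast
  then have "bndN (max m n) (t \<^bold>< u)" unfolding bndN_def by simp
  then show ?case ..
next
  case (Mem t X)
  then show ?case unfolding bndN_def using tm_bnd[of t] by simp
next
  case (Imp p q)
  then obtain m n where "bndN m p" "bndN n q" by blast
  then have "bndN (max m n) p" "bndN (max m n) q" by (auto elim: bndN_mono)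
  then have "bndN (max m n) (p \<^bold>\<longrightarrow> q)"
    unfolding bndN_def by simp
  then show ?case ..
next
  case (AllN p)
  then show ?case using bndN_AllN by blast
next
  case (AllS p)
  then show ?case using bndN_AllS by blast
qed (auto simp: bndN_def)

lemma ex_bndS: "\<exists>n. bndS n p"
proof (induction p)
  case (Mem t X)
  then show ?case unfolding bndS_def by (intro exI[of _ "Suc X"]) simp
next
  case (Imp p q)
  then obtain m n where "bndS m p" "bndS n q" by blast
  then have "bndS (max m n) p" "bndS (max m n) q" by (auto elim: bndS_mono)
  then have "bndS (max m n) (p \<^bold>\<longrightarrow> q)"
    unfolding bndS_def by simp
  then show ?case ..
next
  case (AllN p)
  then show ?case using bndS_AllN by blast
next
  case (AllS p)
  then show ?case using bndS_AllS by blast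
qed (auto simp: bndS_def)

lemma ex_bndN_list: "\<exists>n. \<forall>p\<in>set G. bndN n p"
proof (induction G)
  case (Cons p G)
  then obtain m n where "\<forall>p\<in>set G. bndN m p" "bndN n p" using ex_bndN by blast
  then show ?case by (intro exI[of _ "max m n"]) (auto intro: bndN_mono[OF _ max.cobounded1] bndN_mono[OF _ max.cobounded2])
qed simp

lemma ex_bndS_list: "\<exists>n. \<forall>p\<in>set G. bndS n p"
proof (induction G)
  case (Cons p G)
  then obtain m n where "\<forall>p\<in>set G. bndS m p" "bndS n p" using ex_bndS by blast
  then show ?case by (intro exI[of _ "max m n"]) (auto intro: bndS_mono[OF _ max.cobounded1] bndS_mono[OF _ max.cobounded2])
qed simp

lemma closedI: "bndN 0 p \<Longrightarrow> bndS 0 p \<Longrightarrow> closed p"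
  unfolding closed_def bndN_def bndS_def by (metis less_nat_zero_code subst_Var substS_id)

text \<open>Each quantifier lowers the bound for its own sort and keeps the one for the other sort,
  so as many quantifiers as the bounds say leave no free variable.\<close>

lemma ex_closure: "\<exists>m n. closed ((AllN ^^ m) ((AllS ^^ n) p))"
proof -
  have N: "bndN (k - m) ((AllN ^^ m) q)" if "bndN k q" for k m q
    using that by (induction m) (auto dest: bndN_AllN)
  have S: "bndS (k - m) ((AllS ^^ m) q)" if "bndS k q" for k m q
    using that by (induction m) (auto dest: bndS_AllS)
  have NS: "bndN k ((AllS ^^ m) q)" if "bndN k q" for k m q
    using that by (induction m) (auto dest: bndN_AllS)
  have SN: "bndS k ((AllN ^^ m) q)" if "bndS k q" for k m q
    using that by (induction m) (auto dest: bndS_AllN)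
  obtain m n where "bndN m p" "bndS n p" using ex_bndN ex_bndS by blast
  then have "closed ((AllN ^^ m) ((AllS ^^ n) p))"
    by (intro closedI) (metis N NS diff_self_eq_0, metis S SN diff_self_eq_0)
  then show ?thesis by blast
qed


section \<open>Admissible rules\<close>

text \<open>Contexts are compared as sets, so exchange and contraction of hypotheses are covered as
  well.\<close>

lemma nd_weaken: "T \<triangleright> G \<turnstile> p \<Longrightarrow> set G \<subseteq> set G' \<Longrightarrow> T \<triangleright> G' \<turnstile> p"
proof (induction arbitrary: G' rule: nd.induct)
  case (Imp_I p G q)
  have "T \<triangleright> p # G' \<turnstile> q" by (rule Imp_I.IH) (use Imp_I.prems in auto)
  then show ?case by (rule nd.Imp_I)
next
  case (Classical p G)
  have "T \<triangleright> \<^bold>\<not> p # G' \<turnstile> \<^bold>\<bottom>" by (rule Classical.IH) (use Classical.prems in auto)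
  then show ?case by (rule nd.Classical)
next
  case (AllN_I G p)
  have "T \<triangleright> map lift G' \<turnstile> p" by (rule AllN_I.IH) (use AllN_I.prems in auto)
  then show ?case by (rule nd.AllN_I)
next
  case (AllS_I G p)
  have "T \<triangleright> map liftS G' \<turnstile> p" by (rule AllS_I.IH) (use AllS_I.prems in auto)
  then show ?case by (rule nd.AllS_I)
next
  case (Eq_subst G t u p)
  then show ?case by (blast intro: nd.Eq_subst)
qed (auto intro: nd.intros)

text \<open>The theory stays the same while the derivation is substituted into; therefore each axiom
  has to be fixed by every substitution.\<close>

lemma nd_subst:
  assumes T: "\<And>p. p \<in> T \<Longrightarrow> closed p"
  shows "T \<triangleright> G \<turnstile> p \<Longrightarrow> T \<triangleright> map (subst \<sigma>) G \<turnstile> subst \<sigma> p"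
proof (induction arbitrary: \<sigma> rule: nd.induct)
  case (Axiom p G)
  then show ?case using T[of p] by (simp add: closed_def nd.Axiom)
next
  case (Classical p G)
  then show ?case using nd.Classical by (simp add: Neg_def)
next
  case (AllN_I G p)
  have "map (subst (up \<sigma>)) (map lift G) = map lift (map (subst \<sigma>) G)" by (simp add: subst_lift)
  then show ?case using AllN_I.IH[of "up \<sigma>"] by (metis nd.AllN_I subst.simps(6))
next
  case (AllS_I G p)
  have "map (subst \<sigma>) (map liftS G) = map liftS (map (subst \<sigma>) G)"
    by (simp add: liftS_def subst_substS)
  then show ?case using AllS_I.IH[of \<sigma>] by (metis nd.AllS_I subst.simps(7))
next
  case (AllN_E G p t)
  then show ?case unfolding subst_inst by (metis nd.AllN_E subst.simps(6))
next
  case (AllS_E G p X)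
  then show ?case unfolding instS_def subst_substS by (metis nd.AllS_E subst.simps(7) instS_def)
next
  case (Eq_subst G t u p)
  then show ?case unfolding subst_inst by (metis nd.Eq_subst subst.simps(1))
qed (auto intro: nd.intros)

lemma nd_substS:
  assumes T: "\<And>p. p \<in> T \<Longrightarrow> closed p"
  shows "T \<triangleright> G \<turnstile> p \<Longrightarrow> T \<triangleright> map (substS \<rho>) G \<turnstile> substS \<rho> p"
proof (induction arbitrary: \<rho> rule: nd.induct)
  case (Axiom p G)
  then show ?case using T[of p] by (simp add: closed_def nd.Axiom)
next
  case (Classical p G)
  then show ?case using nd.Classical by (simp add: Neg_def)
next
  case (AllN_I G p)
  have "map (substS \<rho>) (map lift G) = map lift (map (substS \<rho>) G)"
    by (simp add: lift_def subst_substS)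
  then show ?case using AllN_I.IH[of \<rho>] by (metis nd.AllN_I substS.simps(6))
next
  case (AllS_I G p)
  have "map (substS (upS \<rho>)) (map liftS G) = map liftS (map (substS \<rho>) G)"
    by (simp add: substS_liftS)
  then show ?case using AllS_I.IH[of "upS \<rho>"] by (metis nd.AllS_I substS.simps(7))
next
  case (AllN_E G p t)
  then show ?case unfolding inst_def subst_substS[symmetric]
    by (metis nd.AllN_E substS.simps(6) inst_def)
next
  case (AllS_E G p X)
  then show ?case unfolding substS_instS by (metis nd.AllS_E substS.simps(7))
next
  case (Eq_subst G t u p)
  then show ?case unfolding inst_def subst_substS[symmetric]
    by (metis nd.Eq_subst substS.simps(1) inst_def)
qed (auto intro: nd.intros)

lemma nd_trans_theory:
  "T' \<triangleright> G \<turnstile> p \<Longrightarrow> (\<And>q. q \<in> T' \<Longrightarrow> T \<triangleright> [] \<turnstile> q) \<Longrightarrow> T \<triangleright> G \<turnstile> p"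
proof (induction rule: nd.induct)
  case (Axiom p G)
  then show ?case by (metis empty_set empty_subsetI nd_weaken)
qed (auto intro: nd.intros)

lemma nd_Neg_E: "T \<triangleright> G \<turnstile> \<^bold>\<not> p \<Longrightarrow> T \<triangleright> G \<turnstile> p \<Longrightarrow> T \<triangleright> G \<turnstile> \<^bold>\<bottom>"
  unfolding Neg_def by (rule nd.Imp_E)

lemma nd_cut: "T \<triangleright> p # G \<turnstile> q \<Longrightarrow> T \<triangleright> G \<turnstile> p \<Longrightarrow> T \<triangleright> G \<turnstile> q"
  by (meson nd.Imp_I nd.Imp_E)

text \<open>The eigenvariable rule for a named variable. Renaming \<open>Var c\<close> to
  \<open>Var 0\<close> and shifting all others acts on \<open>G\<close> as \<open>lift\<close>,
  because \<open>c\<close> exceeds its free variables, and undoes the instantiation of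
  \<open>q\<close>.\<close>

lemma fresh_AllN:
  assumes T: "\<And>p. p \<in> T \<Longrightarrow> closed p"
    and G: "\<forall>p\<in>set G. bndN c p" and q: "bndN (Suc c) q"
    and d: "T \<triangleright> G \<turnstile> inst (Var c) q"
  shows "T \<triangleright> G \<turnstile> AllN q"
proof -
  let ?\<sigma> = "\<lambda>n. if n = c then Var 0 else Var (Suc n)"
  have "map (subst ?\<sigma>) G = map lift G"
    unfolding lift_def
  proof (rule map_cong[OF refl])
    fix p assume "p \<in> set G"
    then have "bndN c p" using G by blast
    then show "subst ?\<sigma> p = subst (\<lambda>n. Var (Suc n)) p"
      by (rule bndN_D) simp
  qed
  moreover have "subst ?\<sigma> (inst (Var c) q) = subst Var q"
    unfolding inst_def subst_comp by (rule bndN_D[OF q]) (auto split: nat.split)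
  ultimately have "T \<triangleright> map lift G \<turnstile> q" using nd_subst[OF T d, of ?\<sigma>] by (simp only: subst_Var)
  then show ?thesis by (rule nd.AllN_I)
qed

lemma fresh_AllS:
  assumes T: "\<And>p. p \<in> T \<Longrightarrow> closed p"
    and G: "\<forall>p\<in>set G. bndS c p" and q: "bndS (Suc c) q"
    and d: "T \<triangleright> G \<turnstile> instS c q"
  shows "T \<triangleright> G \<turnstile> AllS q"
proof -
  let ?\<rho> = "\<lambda>n. if n = c then 0 else Suc n"
  have "map (substS ?\<rho>) G = map liftS G"
    unfolding liftS_def
  proof (rule map_cong[OF refl])
    fix p assume "p \<in> set G"
    then have "bndS c p" using G by blast
    then show "substS ?\<rho> p = substS Suc p"
      by (rule bndS_D) simp
  qed
  moreover have "substS ?\<rho> (instS c q) = substS (\<lambda>n. n) q"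
    unfolding instS_def substS_comp by (rule bndS_D[OF q]) (auto split: nat.split)
  ultimately have "T \<triangleright> map liftS G \<turnstile> q" using nd_substS[OF T d, of ?\<rho>] by (simp only: substS_id)
  then show ?thesis by (rule nd.AllS_I)
qed


section \<open>Complete Henkin extensions\<close>

definition consistent :: "fm set \<Rightarrow> fm list \<Rightarrow> bool" where
  "consistent T G \<longleftrightarrow> \<not> (T \<triangleright> G \<turnstile> \<^bold>\<bottom>)"

text \<open>A refuted universal statement must come with a refuted instance, so that quantifiers can
  later be evaluated by membership. Set instances are variables, the only set terms of the
  language.\<close>

definition decided :: "fm set \<Rightarrow> fm \<Rightarrow> bool" where
  "decided A p \<longleftrightarrow> p \<in> A \<or> \<^bold>\<not> p \<in> A \<and> (\<forall>q. p = AllN q \<longrightarrow> (\<exists>t. \<^bold>\<not> inst t q \<in> A))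
     \<and> (\<forall>q. p = AllS q \<longrightarrow> (\<exists>X. \<^bold>\<not> instS X q \<in> A))"

lemma decided_mono: "decided A p \<Longrightarrow> A \<subseteq> B \<Longrightarrow> decided B p"
  unfolding decided_def by blast

lemma consistent_Neg: "consistent T G \<Longrightarrow> \<not> consistent T (p # G) \<Longrightarrow> consistent T (\<^bold>\<not> p # G)"
  unfolding consistent_def by (metis nd.Classical nd_cut)

text \<open>Meant for an instance \<open>r\<close> of \<open>p\<close> at a fresh variable, with
  generalisation as second assumption. If \<open>r\<close> could not be refuted consistently it
  would be derivable, hence \<open>p\<close> too, against the hypothesis negating
  \<open>p\<close>.\<close>

lemma consistent_counterexample:
  assumes "consistent T (\<^bold>\<not> p # G)" and "T \<triangleright> \<^bold>\<not> p # G \<turnstile> r \<Longrightarrow> T \<triangleright> \<^bold>\<not> p # G \<turnstile> p"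
  shows "consistent T (\<^bold>\<not> r # \<^bold>\<not> p # G)"
  using assms unfolding consistent_def
  by (metis Hyp list.set_intros(1) nd.Classical nd_Neg_E)

text \<open>The context is a finite list, so some variable lies above all its free variables; it
  serves as the counterexample to a refuted quantified formula.\<close>

lemma decide_step:
  assumes T: "\<And>p. p \<in> T \<Longrightarrow> closed p" and con: "consistent T G"
  shows "\<exists>G'. consistent T G' \<and> set G \<subseteq> set G' \<and> decided (set G') p"
proof (cases "consistent T (p # G)")
  case True
  then show ?thesis by (intro exI[of _ "p # G"]) (auto simp: decided_def)
next
  case False
  then have neg: "consistent T (\<^bold>\<not> p # G)" using con consistent_Neg by blast
  consider (N) q where "p = AllN q" | (S) q where "p = AllS q"
    | (other) "\<forall>q. p \<noteq> AllN q \<and> p \<noteq> AllS q" by blast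
  then show ?thesis
  proof cases
    case (N q)
    obtain m n where m: "\<forall>r\<in>set (\<^bold>\<not> p # G). bndN m r" and n: "bndN n q"
      using ex_bndN_list ex_bndN by blast
    define c where "c = max m n"
    have "\<forall>r\<in>set (\<^bold>\<not> p # G). bndN c r" "bndN (Suc c) q"
      using m n by (auto simp: c_def intro: bndN_mono)
    then have "consistent T (\<^bold>\<not> inst (Var c) q # \<^bold>\<not> p # G)"
      using consistent_counterexample[OF neg] fresh_AllN[OF T] N by blast
    then show ?thesis using N
      by (intro exI[of _ "\<^bold>\<not> inst (Var c) q # \<^bold>\<not> p # G"]) (auto simp: decided_def)
  next
    case (S q)
    obtain m n where m: "\<forall>r\<in>set (\<^bold>\<not> p # G). bndS m r" and n: "bndS n q"
      using ex_bndS_list ex_bndS by blast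
    define c where "c = max m n"
    have "\<forall>r\<in>set (\<^bold>\<not> p # G). bndS c r" "bndS (Suc c) q"
      using m n by (auto simp: c_def intro: bndS_mono)
    then have "consistent T (\<^bold>\<not> instS c q # \<^bold>\<not> p # G)"
      using consistent_counterexample[OF neg] fresh_AllS[OF T] S by blast
    then show ?thesis using S
      by (intro exI[of _ "\<^bold>\<not> instS c q # \<^bold>\<not> p # G"]) (auto simp: decided_def)
  next
    case other
    then show ?thesis using neg by (intro exI[of _ "\<^bold>\<not> p # G"]) (auto simp: decided_def)
  qed
qed

instance tm :: countable by countable_datatype
instance fm :: countable by countable_datatype

text \<open>Lindenbaum's construction: stage \<open>n\<close> is a finite list, and the step to the
  next stage decides the formula numbered \<open>n\<close>. The result is the union of all
  stages.\<close>

lemma ex_henkin: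
  assumes T: "\<And>p. p \<in> T \<Longrightarrow> closed p" and con: "consistent T G"
  shows "\<exists>H. set G \<subseteq> H \<and> (\<forall>p. decided H p) \<and> (\<forall>G. set G \<subseteq> H \<longrightarrow> consistent T G)"
proof -
  define P where "P n L \<longleftrightarrow> consistent T L \<and> set G \<subseteq> set L" for n :: nat and L
  define Q where "Q n L L' \<longleftrightarrow> set L \<subseteq> set L' \<and> decided (set L') (from_nat n)" for n and L L' :: "fm list"
  have "\<exists>f. \<forall>n. P n (f n) \<and> Q n (f n) (f (Suc n))"
  proof (rule dependent_nat_choice)
    show "\<exists>L. P 0 L" using con by (auto simp: P_def)
  next
    fix L n assume "P n L"
    then show "\<exists>L'. P (Suc n) L' \<and> Q n L L'"
      using decide_step[of T L "from_nat n", OF T] unfolding P_def Q_def by blast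
  qed
  then obtain F where P: "P n (F n)" and Q: "Q n (F n) (F (Suc n))" for n by blast
  have mono: "set (F m) \<subseteq> set (F n)" if "m \<le> n" for m n
    using that by (rule lift_Suc_mono_le[rotated]) (use Q in \<open>auto simp: Q_def\<close>)
  define H where "H = (\<Union>n. set (F n))"
  have "set G \<subseteq> H" using P unfolding P_def H_def by blast
  moreover have "decided H p" for p
    using Q[of "to_nat p"] unfolding Q_def H_def
    by (metis UN_upper UNIV_I decided_mono from_nat_to_nat)
  moreover have "consistent T L" if L: "set L \<subseteq> H" for L
  proof -
    \<comment> \<open>As the stages increase, a finite part of the union lies in one of them and
      inherits its consistency.\<close>
    have "\<exists>n. set L' \<subseteq> set (F n)" if "set L' \<subseteq> H" for L'
      using that
    proof (induction L')
      case (Cons p L')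
      then obtain m n where "set L' \<subseteq> set (F m)" "p \<in> set (F n)" by (auto simp: H_def)
      then show ?case using mono[of m "max m n"] mono[of n "max m n"]
        by (intro exI[of _ "max m n"]) auto
    qed simp
    then obtain n where "set L \<subseteq> set (F n)" using L by blast
    then show ?thesis using P[of n] nd_weaken unfolding P_def consistent_def by blast
  qed
  ultimately show ?thesis by blast
qed

section \<open>Truth as membership in a complete Henkin set\<close>

locale henkin =
  fixes T :: "fm set" and H :: "fm set"
  assumes decided: "decided H p"
    and finite_consistent: "set G \<subseteq> H \<Longrightarrow> consistent T G"
begin

text \<open>Otherwise the negation of \<open>p\<close> is in \<open>H\<close>, and together with
  \<open>G\<close> it forms an inconsistent finite part of \<open>H\<close>.\<close>

lemma closedH: "T \<triangleright> G \<turnstile> p \<Longrightarrow> set G \<subseteq> H \<Longrightarrow> p \<in> H"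
proof (rule ccontr)
  assume d: "T \<triangleright> G \<turnstile> p" and G: "set G \<subseteq> H" and "p \<notin> H"
  then have "\<^bold>\<not> p \<in> H" using decided[of p] by (auto simp: decided_def)
  then have "consistent T (\<^bold>\<not> p # G)" using G by (intro finite_consistent) simp
  moreover have "T \<triangleright> \<^bold>\<not> p # G \<turnstile> p" using d by (rule nd_weaken) auto
  ultimately show False
    unfolding consistent_def by (meson Hyp list.set_intros(1) nd_Neg_E)
qed

lemma Falsum_H: "\<^bold>\<bottom> \<notin> H"
  using finite_consistent[of "[\<^bold>\<bottom>]"] nd.Hyp[of "\<^bold>\<bottom>" "[\<^bold>\<bottom>]" T] by (auto simp: consistent_def)

lemma Imp_H: "(p \<^bold>\<longrightarrow> q) \<in> H \<longleftrightarrow> (p \<in> H \<longrightarrow> q \<in> H)"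
proof
  assume "(p \<^bold>\<longrightarrow> q) \<in> H"
  moreover have "T \<triangleright> [p \<^bold>\<longrightarrow> q, p] \<turnstile> q" by (rule nd.Imp_E[of _ _ p]; rule nd.Hyp; simp)
  ultimately show "p \<in> H \<longrightarrow> q \<in> H" by (auto dest: closedH)
next
  assume *: "p \<in> H \<longrightarrow> q \<in> H"
  show "(p \<^bold>\<longrightarrow> q) \<in> H"
  proof (cases "p \<in> H")
    case True
    then show ?thesis using * by (intro closedH[of "[q]"] nd.Imp_I nd.Hyp) auto
  next
    case False
    then have n: "\<^bold>\<not> p \<in> H" using decided[of p] by (auto simp: decided_def)
    have "T \<triangleright> [p, \<^bold>\<not> p] \<turnstile> \<^bold>\<bottom>" by (rule nd_Neg_E[of _ _ p]) (auto intro: nd.Hyp)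
    then have "T \<triangleright> [\<^bold>\<not> q, p, \<^bold>\<not> p] \<turnstile> \<^bold>\<bottom>" by (rule nd_weaken) auto
    then have "T \<triangleright> [\<^bold>\<not> p] \<turnstile> p \<^bold>\<longrightarrow> q" by (rule nd.Imp_I[OF nd.Classical])
    then show ?thesis using n by (intro closedH) auto
  qed
qed

lemma Neg_H: "\<^bold>\<not> p \<in> H \<longleftrightarrow> p \<notin> H"
  unfolding Neg_def by (simp add: Imp_H Falsum_H)

lemma AllN_H: "AllN p \<in> H \<longleftrightarrow> (\<forall>t. inst t p \<in> H)"
proof
  assume "AllN p \<in> H"
  then show "\<forall>t. inst t p \<in> H"
    by (intro allI closedH[of "[AllN p]"] nd.AllN_E) (auto intro: nd.Hyp)
next
  assume "\<forall>t. inst t p \<in> H"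
  then show "AllN p \<in> H"
    using decided[of "AllN p"] unfolding decided_def Neg_H by blast
qed

lemma AllS_H: "AllS p \<in> H \<longleftrightarrow> (\<forall>X. instS X p \<in> H)"
proof
  assume "AllS p \<in> H"
  then show "\<forall>X. instS X p \<in> H"
    by (intro allI closedH[of "[AllS p]"] nd.AllS_E) (auto intro: nd.Hyp)
next
  assume "\<forall>X. instS X p \<in> H"
  then show "AllS p \<in> H"
    using decided[of "AllS p"] unfolding decided_def Neg_H by blast
qed

lemma Eq_refl_H: "(t \<^bold>= t) \<in> H"
  by (rule closedH[of "[]"]) (auto intro: nd.Eq_refl)

lemma Eq_subst_H: "(t \<^bold>= u) \<in> H \<Longrightarrow> inst t p \<in> H \<Longrightarrow> inst u p \<in> H"
  by (rule closedH[of "[t \<^bold>= u, inst t p]", OF nd.Eq_subst[of _ _ t u p, OF nd.Hyp nd.Hyp]]) auto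

lemma inst_shift [simp]: "subst_tm (case_nat t Var) (lift_tm u) = u"
  by (simp add: lift_tm_def subst_tm_comp)

text \<open>Leibniz's rule for a formula whose hole is \<open>Var 0\<close>; the other terms are
  lifted so that instantiation leaves them alone. The congruence laws below follow the same
  pattern.\<close>

lemma Eq_sym_H: "(t \<^bold>= u) \<in> H \<Longrightarrow> (u \<^bold>= t) \<in> H"
  using Eq_subst_H[of t u "Var 0 \<^bold>= lift_tm t"] by (simp add: inst_def Eq_refl_H)

lemma Eq_trans_H: "(t \<^bold>= u) \<in> H \<Longrightarrow> (u \<^bold>= v) \<in> H \<Longrightarrow> (t \<^bold>= v) \<in> H"
  using Eq_subst_H[of u v "lift_tm t \<^bold>= Var 0"] by (simp add: inst_def)

lemma Eq_Add_H:
  assumes "(t \<^bold>= t') \<in> H" and "(u \<^bold>= u') \<in> H"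
  shows "(t \<^bold>+ u \<^bold>= t' \<^bold>+ u') \<in> H"
  using Eq_subst_H[OF assms(1), of "lift_tm (t \<^bold>+ u) \<^bold>= Var 0 \<^bold>+ lift_tm u"]
    Eq_subst_H[OF assms(2), of "lift_tm (t \<^bold>+ u) \<^bold>= lift_tm t' \<^bold>+ Var 0"]
  by (simp add: inst_def Eq_refl_H)

lemma Eq_Mul_H:
  assumes "(t \<^bold>= t') \<in> H" and "(u \<^bold>= u') \<in> H"
  shows "(t \<^bold>* u \<^bold>= t' \<^bold>* u') \<in> H"
  using Eq_subst_H[OF assms(1), of "lift_tm (t \<^bold>* u) \<^bold>= Var 0 \<^bold>* lift_tm u"]
    Eq_subst_H[OF assms(2), of "lift_tm (t \<^bold>* u) \<^bold>= lift_tm t' \<^bold>* Var 0"]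
  by (simp add: inst_def Eq_refl_H)

lemma Less_H:
  assumes "(t \<^bold>= t') \<in> H" and "(u \<^bold>= u') \<in> H" and "(t \<^bold>< u) \<in> H"
  shows "(t' \<^bold>< u') \<in> H"
  using Eq_subst_H[OF assms(1), of "Var 0 \<^bold>< lift_tm u"]
    Eq_subst_H[OF assms(2), of "lift_tm t' \<^bold>< Var 0"] assms(3)
  by (simp add: inst_def)

lemma Mem_H: "(t \<^bold>= t') \<in> H \<Longrightarrow> (t \<^bold>\<in> X) \<in> H \<Longrightarrow> (t' \<^bold>\<in> X) \<in> H"
  using Eq_subst_H[of t t' "Var 0 \<^bold>\<in> X"] by (simp add: inst_def)

end


section \<open>Semantics\<close>

locale interp =
  fixes zero one :: 'n and add mul :: "'n \<Rightarrow> 'n \<Rightarrow> 'n" and less :: "'n \<Rightarrow> 'n \<Rightarrow> bool"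
    and mem :: "'n \<Rightarrow> 's \<Rightarrow> bool"
begin

primrec tmval :: "(nat \<Rightarrow> 'n) \<Rightarrow> tm \<Rightarrow> 'n" where
  "tmval e (Var n) = e n"
| "tmval e \<^bold>0 = zero"
| "tmval e \<^bold>1 = one"
| "tmval e (t \<^bold>+ u) = add (tmval e t) (tmval e u)"
| "tmval e (t \<^bold>* u) = mul (tmval e t) (tmval e u)"

primrec sat :: "(nat \<Rightarrow> 'n) \<Rightarrow> (nat \<Rightarrow> 's) \<Rightarrow> fm \<Rightarrow> bool" where
  "sat e s (t \<^bold>= u) \<longleftrightarrow> tmval e t = tmval e u"
| "sat e s (t \<^bold>< u) \<longleftrightarrow> less (tmval e t) (tmval e u)"
| "sat e s (t \<^bold>\<in> X) \<longleftrightarrow> mem (tmval e t) (s X)"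
| "sat e s \<^bold>\<bottom> \<longleftrightarrow> False"
| "sat e s (p \<^bold>\<longrightarrow> q) \<longleftrightarrow> (sat e s p \<longrightarrow> sat e s q)"
| "sat e s (AllN p) \<longleftrightarrow> (\<forall>x. sat (case_nat x e) s p)"
| "sat e s (AllS p) \<longleftrightarrow> (\<forall>X. sat e (case_nat X s) p)"

lemma tmval_subst: "tmval e (subst_tm \<sigma> t) = tmval (\<lambda>n. tmval e (\<sigma> n)) t"
  by (induction t) auto

lemma tmval_lift [simp]: "tmval (case_nat x e) (lift_tm t) = tmval e t"
  by (simp add: lift_tm_def tmval_subst)

lemma case_nat_tmval_up: "(\<lambda>n. tmval (case_nat x e) (up \<sigma> n)) = case_nat x (\<lambda>n. tmval e (\<sigma> n))"
  by (auto simp: up_def fun_eq_iff split: nat.split)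

lemma sat_subst: "sat e s (subst \<sigma> p) \<longleftrightarrow> sat (\<lambda>n. tmval e (\<sigma> n)) s p"
  by (induction p arbitrary: e s \<sigma>) (auto simp: tmval_subst case_nat_tmval_up)

lemma case_nat_upS: "(\<lambda>n. case_nat X s (upS \<rho> n)) = case_nat X (\<lambda>n. s (\<rho> n))"
  by (auto simp: upS_def fun_eq_iff split: nat.split)

lemma sat_substS: "sat e s (substS \<rho> p) \<longleftrightarrow> sat e (\<lambda>n. s (\<rho> n)) p"
  by (induction p arbitrary: e s \<rho>) (auto simp: case_nat_upS)

text \<open>Every assignment splits into a value for index 0 and a remainder, so leading universal
  quantifiers do not affect validity under all assignments.\<close>

lemma sat_closure:
  "(\<forall>e s. sat e s ((AllN ^^ m) ((AllS ^^ n) p))) \<longleftrightarrow> (\<forall>e s. sat e s p)"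
proof -
  have *: "\<exists>x e'. e = case_nat x e'" for e :: "nat \<Rightarrow> 'c"
    by (intro exI[of _ "e 0"] exI[of _ "\<lambda>n. e (Suc n)"]) (auto split: nat.split)
  have N: "(\<forall>e s. sat e s (AllN q)) \<longleftrightarrow> (\<forall>e s. sat e s q)" for q by simp (metis *)
  have S: "(\<forall>e s. sat e s (AllS q)) \<longleftrightarrow> (\<forall>e s. sat e s q)" for q by simp (metis *)
  have "(\<forall>e s. sat e s ((AllN ^^ m) q)) \<longleftrightarrow> (\<forall>e s. sat e s q)" for q
    by (induction m) (simp_all only: funpow.simps o_apply id_apply N)
  moreover have "(\<forall>e s. sat e s ((AllS ^^ n) q)) \<longleftrightarrow> (\<forall>e s. sat e s q)" for q
    by (induction n) (simp_all only: funpow.simps o_apply id_apply S)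
  ultimately show ?thesis by simp
qed

end

section \<open>The term model\<close>

context henkin
begin

definition eqv :: "(tm \<times> tm) set" where
  "eqv = {(t, u). (t \<^bold>= u) \<in> H}"

lemma equiv_eqv: "equiv UNIV eqv"
  by (rule equivI) (auto simp: eqv_def refl_on_def sym_def trans_def
      intro: Eq_refl_H Eq_sym_H Eq_trans_H)

text \<open>The numbers of the model are terms modulo equality in \<open>H\<close>, and set
  variables denote themselves. As \<open>H\<close> arises only inside a proof, the classes are
  renumbered by \<open>nat\<close> to get a fixed carrier type, which is possible because they are
  countably infinite in number.\<close>

lemma ex_model:
  assumes inf: "infinite (UNIV // eqv)"
  shows "\<exists>(zero :: nat) one add mul less (mem :: nat \<Rightarrow> nat \<Rightarrow> bool) h. surj h \<and>
    (\<forall>\<sigma> \<rho> p. interp.sat zero one add mul less mem (\<lambda>n. h (\<sigma> n)) \<rho> p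
      \<longleftrightarrow> subst \<sigma> (substS \<rho> p) \<in> H)"
proof -
  have "countable (UNIV // eqv)" unfolding quotient_def by auto
  then have "bij_betw (to_nat_on (UNIV // eqv)) (UNIV // eqv) UNIV"
    using inf by (rule to_nat_on_infinite)
  then obtain b :: "tm set \<Rightarrow> nat" where b: "bij_betw b (UNIV // eqv) UNIV" by blast
  define h where "h t = b (eqv `` {t})" for t
  have h_eq: "h t = h u \<longleftrightarrow> (t \<^bold>= u) \<in> H" for t u
  proof -
    have "h t = h u \<longleftrightarrow> eqv `` {t} = eqv `` {u}"
      unfolding h_def using b by (auto simp: bij_betw_def inj_on_def quotient_def)
    then show ?thesis
      using eq_equiv_class_iff[OF equiv_eqv, of t u] by (simp add: eqv_def)
  qed
  have h_surj: "\<exists>t. x = h t" for x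
  proof -
    have "x \<in> b ` (UNIV // eqv)" using b by (simp add: bij_betw_def)
    then show ?thesis unfolding h_def quotient_def by auto
  qed
  \<comment> \<open>\<open>g\<close> picks a representative term of each class. The operations are
    defined through it, and the congruence laws make them independent of the choice.\<close>
  define g where "g x = (SOME t. x = h t)" for x
  have hg [simp]: "h (g x) = x" for x unfolding g_def using someI_ex[OF h_surj] by metis
  have gh: "(g (h t) \<^bold>= t) \<in> H" for t using h_eq hg by blast
  define add where "add x y = h (g x \<^bold>+ g y)" for x y
  define mul where "mul x y = h (g x \<^bold>* g y)" for x y
  define less where "less x y \<longleftrightarrow> (g x \<^bold>< g y) \<in> H" for x y
  define mem where "mem x X \<longleftrightarrow> (g x \<^bold>\<in> X) \<in> H" for x and X :: nat
  have add_h: "add (h t) (h u) = h (t \<^bold>+ u)" for t u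
    unfolding add_def h_eq by (intro Eq_Add_H gh)
  have mul_h: "mul (h t) (h u) = h (t \<^bold>* u)" for t u
    unfolding mul_def h_eq by (intro Eq_Mul_H gh)
  have less_h: "less (h t) (h u) \<longleftrightarrow> (t \<^bold>< u) \<in> H" for t u
    unfolding less_def by (meson Less_H gh Eq_sym_H)
  have mem_h: "mem (h t) X \<longleftrightarrow> (t \<^bold>\<in> X) \<in> H" for t X
    unfolding mem_def by (meson Mem_H gh Eq_sym_H)
  interpret interp "h \<^bold>0" "h \<^bold>1" add mul less mem .
  have tm: "tmval (\<lambda>n. h (\<sigma> n)) t = h (subst_tm \<sigma> t)" for \<sigma> t
    by (induction t) (simp_all add: add_h mul_h)
  \<comment> \<open>The truth lemma. It is proved for all substitutions at once, because a
    quantifier extends the substitution by an arbitrary term.\<close>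
  have "sat (\<lambda>n. h (\<sigma> n)) \<rho> p \<longleftrightarrow> subst \<sigma> (substS \<rho> p) \<in> H" for \<sigma> \<rho> p
  proof (induction p arbitrary: \<sigma> \<rho>)
    case (AllN p)
    have "sat (\<lambda>n. h (\<sigma> n)) \<rho> (AllN p) \<longleftrightarrow> (\<forall>t. sat (case_nat (h t) (\<lambda>n. h (\<sigma> n))) \<rho> p)"
      by simp (metis h_surj)
    also have "\<dots> \<longleftrightarrow> (\<forall>t. subst (case_nat t \<sigma>) (substS \<rho> p) \<in> H)"
    proof -
      have "case_nat (h t) (\<lambda>n. h (\<sigma> n)) = (\<lambda>n. h (case_nat t \<sigma> n))" for t
        by (auto split: nat.split)
      then show ?thesis by (simp add: AllN.IH)
    qed
    also have "\<dots> \<longleftrightarrow> (\<forall>t. inst t (subst (up \<sigma>) (substS \<rho> p)) \<in> H)"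
    proof -
      have "(\<lambda>n. subst_tm (case_nat t Var) (up \<sigma> n)) = case_nat t \<sigma>" for t
        by (auto simp: up_def split: nat.split)
      then show ?thesis by (simp add: inst_def subst_comp)
    qed
    finally show ?case by (simp add: AllN_H)
  next
    case (AllS p)
    have "(\<lambda>n. case_nat X (\<lambda>n. n) (upS \<rho> n)) = case_nat X \<rho>" for X
      by (auto simp: upS_def split: nat.split)
    then show ?case by (simp add: AllS.IH AllS_H instS_def subst_substS[symmetric] substS_comp)
  qed (auto simp: tm h_eq less_h mem_h Falsum_H Imp_H)
  moreover have "surj h" unfolding surj_def using h_surj by blast
  ultimately show ?thesis by blast
qed

end

text \<open>A Henkin set containing the negation of \<open>p\<close> yields the countermodel.
  Provably distinct numerals guarantee infinitely many classes of terms, hence the carrier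
  \<open>nat\<close>.\<close>

theorem completeness:
  assumes np: "\<not> T \<turnstile> p" and num: "\<And>m n. m < n \<Longrightarrow> T \<turnstile> \<^bold>\<not> (num m \<^bold>= num n)"
  shows "\<exists>(zero :: nat) one add mul less (mem :: nat \<Rightarrow> nat \<Rightarrow> bool).
    (\<forall>q\<in>T. \<forall>e s. interp.sat zero one add mul less mem e s q) \<and>
    (\<exists>e s. \<not> interp.sat zero one add mul less mem e s p)"
proof -
  \<comment> \<open>The axioms have free variables, whereas renaming eigenvariables calls for closed
    ones. The closed consequences of \<open>T\<close> replace them and include their universal
    closures.\<close>
  define T' where "T' = {q. closed q \<and> T \<turnstile> q}"
  have T': "closed q" if "q \<in> T'" for q using that by (simp add: T'_def)
  have "\<not> T' \<triangleright> [] \<turnstile> p"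
    using np nd_trans_theory[of T' "[]" p T] unfolding T'_def provable_def by blast
  then have "consistent T' [\<^bold>\<not> p]" unfolding consistent_def using nd.Classical by blast
  then obtain H where H: "\<^bold>\<not> p \<in> H" "\<And>p. decided H p" "\<And>G. set G \<subseteq> H \<Longrightarrow> consistent T' G"
    using ex_henkin[OF T'] by (metis insert_subset list.simps(15))
  interpret henkin T' H using H by unfold_locales auto
  have T'H: "q \<in> H" if "q \<in> T'" for q using that by (auto intro: closedH[of "[]"] nd.Axiom)
  have num_H: "(num m \<^bold>= num n) \<notin> H" if "m < n" for m n
  proof -
    have cl: "subst_tm \<sigma> (num k) = num k" for \<sigma> k by (induction k) auto
    have "\<^bold>\<not> (num m \<^bold>= num n) \<in> T'"
      using num[OF that] by (simp add: T'_def closed_def Neg_def cl)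
    then show ?thesis using T'H Neg_H by blast
  qed
  have "inj (\<lambda>n. eqv `` {num n})"
  proof (rule linorder_injI)
    fix m n :: nat assume "m < n"
    then have "(num m, num n) \<notin> eqv" using num_H by (simp add: eqv_def)
    then show "eqv `` {num m} \<noteq> eqv `` {num n}"
      using eq_equiv_class_iff[OF equiv_eqv, of "num m" "num n"] by simp
  qed
  moreover have "range (\<lambda>n. eqv `` {num n}) \<subseteq> UNIV // eqv" by (auto simp: quotient_def)
  ultimately have "infinite (UNIV // eqv)" by (meson infinite_iff_countable_subset)
  from ex_model[OF this] obtain zero one add mul less and mem :: "nat \<Rightarrow> nat \<Rightarrow> bool" and h
    where h: "surj h" and sat: "\<And>\<sigma> \<rho> p. interp.sat (zero::nat) one add mul less mem
      (\<lambda>n. h (\<sigma> n)) \<rho> p \<longleftrightarrow> subst \<sigma> (substS \<rho> p) \<in> H" by blast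
  interpret interp zero one add mul less mem .
  have "sat e s q" if q: "q \<in> T" for q e s
  proof -
    obtain m n where c: "closed ((AllN ^^ m) ((AllS ^^ n) q))" (is "closed ?r")
      using ex_closure by blast
    have S: "T \<triangleright> [] \<turnstile> (AllS ^^ n) q"
      by (induction n) (use q in \<open>auto intro: nd.Axiom nd.AllS_I\<close>)
    have "T \<triangleright> [] \<turnstile> ?r"
      by (induction m) (use S in \<open>auto intro: nd.AllN_I\<close>)
    then have r: "?r \<in> H" using c T'H by (simp add: T'_def provable_def)
    have "sat e s ?r" for e s
    proof -
      \<comment> \<open>Surjectivity of \<open>h\<close> presents any assignment by terms, and the
        closure \<open>?r\<close> is unchanged by the corresponding substitution.\<close>
      have "e = (\<lambda>n. h (inv h (e n)))" using h by (simp add: surj_f_inv_f)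
      then show ?thesis using sat[of "\<lambda>n. inv h (e n)" s ?r] r c unfolding closed_def by metis
    qed
    then show ?thesis using sat_closure by blast
  qed
  moreover have "\<not> sat (\<lambda>n. h (Var n)) (\<lambda>n. n) p" using H(1) by (simp add: sat Neg_H)
  ultimately show ?thesis by blast
qed


section \<open>Models of RCA0\<close>

lemma Delta00_Neg: "p \<in> Delta00 \<Longrightarrow> \<^bold>\<not> p \<in> Delta00"
  unfolding Neg_def by (intro Delta00.intros)

lemma Delta00_Con: "p \<in> Delta00 \<Longrightarrow> q \<in> Delta00 \<Longrightarrow> p \<^bold>\<and> q \<in> Delta00"
  unfolding Con_def by (intro Delta00.intros Delta00_Neg)

lemma Delta00_Dis: "p \<in> Delta00 \<Longrightarrow> q \<in> Delta00 \<Longrightarrow> p \<^bold>\<or> q \<in> Delta00"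
  unfolding Dis_def by (intro Delta00.intros Delta00_Neg)

lemma Delta00_Iff: "p \<in> Delta00 \<Longrightarrow> q \<in> Delta00 \<Longrightarrow> (p \<^bold>\<longleftrightarrow> q) \<in> Delta00"
  unfolding Iff_def by (intro Delta00.intros Delta00_Con)

lemma Delta00_colour: "colour C i j s \<in> Delta00"
  unfolding colour_def by (intro Delta00.intros)

lemmas Delta00_intros = Delta00.intros Delta00_Neg Delta00_Con Delta00_Dis Delta00_Iff Delta00_colour

lemma subst_up_lift_tm: "subst_tm (up \<sigma>) (lift_tm t) = lift_tm (subst_tm \<sigma> t)"
  by (simp add: lift_tm_def subst_tm_comp up_def)

text \<open>Substitution commutes with lifting the bound past its quantifier, so a bounded
  quantifier keeps its shape.\<close>

lemma Delta00_subst: "p \<in> Delta00 \<Longrightarrow> subst \<sigma> p \<in> Delta00"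
proof (induction arbitrary: \<sigma> rule: Delta00.induct)
  case (6 p t)
  then have "AllB (subst_tm \<sigma> t) (subst (up \<sigma>) p) \<in> Delta00" by (intro Delta00_intros)
  then show ?case by (simp add: AllB_def subst_up_lift_tm) (simp add: up_def)
next
  case (7 p t)
  then have "ExB (subst_tm \<sigma> t) (subst (up \<sigma>) p) \<in> Delta00" by (intro Delta00_intros)
  then show ?case by (simp add: ExB_def ExN_def Con_def Neg_def subst_up_lift_tm) (simp add: up_def)
qed (auto intro: Delta00_intros)

lemma Delta00_lift: "p \<in> Delta00 \<Longrightarrow> lift p \<in> Delta00"
  unfolding lift_def by (rule Delta00_subst)

context interp
begin

lemma sat_Neg [simp]: "sat e s (\<^bold>\<not> p) \<longleftrightarrow> \<not> sat e s p"
  by (simp add: Neg_def)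

lemma sat_Con [simp]: "sat e s (p \<^bold>\<and> q) \<longleftrightarrow> sat e s p \<and> sat e s q"
  by (simp add: Con_def)

lemma sat_Dis [simp]: "sat e s (p \<^bold>\<or> q) \<longleftrightarrow> sat e s p \<or> sat e s q"
  by (auto simp: Dis_def)

lemma sat_Iff [simp]: "sat e s (p \<^bold>\<longleftrightarrow> q) \<longleftrightarrow> (sat e s p \<longleftrightarrow> sat e s q)"
  by (auto simp: Iff_def)

lemma sat_ExN [simp]: "sat e s (ExN p) \<longleftrightarrow> (\<exists>x. sat (case_nat x e) s p)"
  by (simp add: ExN_def)

lemma sat_ExS [simp]: "sat e s (ExS p) \<longleftrightarrow> (\<exists>X. sat e (case_nat X s) p)"
  by (simp add: ExS_def)

lemma sat_AllB [simp]:
  "sat e s (AllB t p) \<longleftrightarrow> (\<forall>x. less x (tmval e t) \<longrightarrow> sat (case_nat x e) s p)"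
  by (simp add: AllB_def)

lemma sat_ExB [simp]:
  "sat e s (ExB t p) \<longleftrightarrow> (\<exists>x. less x (tmval e t) \<and> sat (case_nat x e) s p)"
  by (simp add: ExB_def)

lemma sat_Conj [simp]: "sat e s (Conj ps) \<longleftrightarrow> (\<forall>p\<in>set ps. sat e s p)"
  by (induction ps) (auto simp: Conj_def)

lemma sat_Disj [simp]: "sat e s (Disj ps) \<longleftrightarrow> (\<exists>p\<in>set ps. sat e s p)"
  by (induction ps) (auto simp: Disj_def)

lemma sat_inst: "sat e s (inst t p) \<longleftrightarrow> sat (case_nat (tmval e t) e) s p"
proof -
  have "(\<lambda>n. tmval e (case_nat t Var n)) = case_nat (tmval e t) e"
    by (auto split: nat.split)
  then show ?thesis by (simp add: inst_def sat_subst)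
qed

lemma sat_succ_inst: "sat (case_nat x e) s (succ_inst p) \<longleftrightarrow> sat (case_nat (add x one) e) s p"
proof -
  have "(\<lambda>n. tmval (case_nat x e) (case_nat (Var 0 \<^bold>+ \<^bold>1) (\<lambda>n. Var (Suc n)) n)) = case_nat (add x one) e"
    by (auto split: nat.split)
  then show ?thesis by (simp add: succ_inst_def sat_subst)
qed

lemma sat_lift [simp]: "sat (case_nat x e) s (lift p) \<longleftrightarrow> sat e s p"
  by (simp add: lift_def sat_subst)

lemma sat_liftS [simp]: "sat e (case_nat X s) (liftS p) \<longleftrightarrow> sat e s p"
  by (simp add: liftS_def sat_substS)

text \<open>The standard elements of a possibly nonstandard model.\<close>

primrec numval :: "nat \<Rightarrow> 'n" where
  "numval 0 = zero"
| "numval (Suc n) = add (numval n) one"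

lemma tmval_num [simp]: "tmval e (num n) = numval n"
  by (induction n) auto

end

section \<open>Induction and comprehension as principles about predicates on the model\<close>

locale rca_model = interp zero one add mul less mem
  for zero :: 'n ("\<zero>") and one :: 'n ("\<one>") and add (infixl "\<oplus>" 65) and mul (infixl "\<otimes>" 70)
    and less (infix "\<prec>" 50) and mem :: "'n \<Rightarrow> 's \<Rightarrow> bool" (infix "\<in>\<in>" 50) +
  assumes ax: "p \<in> RCA0 \<Longrightarrow> sat e s p"
begin

abbreviation scons (infixr "##" 64) where "x ## e \<equiv> case_nat x e"

text \<open>\<open>p\<close> is the matrix of the \<Sigma>-formula and \<open>P\<close> its meaning
  in the model: index 0 is the existential witness, index 1 the induction variable, and the
  parameters follow.\<close>

lemma sigma_induct:
  assumes "p \<in> Delta00" and P: "\<And>x. (\<exists>y. sat (y ## x ## e) s p) \<longleftrightarrow> P x"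
    and "P \<zero>" and "\<And>x. P x \<Longrightarrow> P (x \<oplus> \<one>)"
  shows "P x"
proof -
  have "induction_axiom (ExN p) \<in> RCA0"
    using assms(1) by (auto simp: RCA0_def Sigma01_def)
  then have "sat e s (induction_axiom (ExN p))" by (rule ax)
  then show ?thesis
    using assms(3,4) by (simp add: induction_axiom_def sat_inst sat_succ_inst P del: sat_ExN)
      (simp add: P)
qed

text \<open>Lifting puts a dummy existential quantifier in front of a bounded formula.\<close>

lemma delta_induct:
  assumes "p \<in> Delta00" and "\<And>x. sat (x ## e) s p \<longleftrightarrow> P x"
    and "P \<zero>" and "\<And>x. P x \<Longrightarrow> P (x \<oplus> \<one>)"
  shows "P x"
  by (rule sigma_induct[of "lift p" e s P]) (use assms in \<open>auto intro: Delta00_lift\<close>)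

lemma delta1_comprehension:
  assumes "p \<in> Delta00" "q \<in> Delta00"
    and "\<And>x. (\<exists>y. sat (y ## x ## e) s p) \<longleftrightarrow> P x" "\<And>x. (\<forall>y. sat (y ## x ## e) s q) \<longleftrightarrow> P x"
  shows "\<exists>X. \<forall>x. x \<in>\<in> X \<longleftrightarrow> P x"
proof -
  have "comprehension_axiom (ExN p) (AllN q) \<in> RCA0"
    using assms(1,2) unfolding RCA0_def Sigma01_def Pi01_def by blast
  then have "sat e s (comprehension_axiom (ExN p) (AllN q))" by (rule ax)
  then show ?thesis
    using assms(3,4) by (simp add: comprehension_axiom_def)
qed

lemma delta0_comprehension:
  assumes "p \<in> Delta00" and "\<And>x. sat (x ## e) s p \<longleftrightarrow> P x"
  shows "\<exists>X. \<forall>x. x \<in>\<in> X \<longleftrightarrow> P x"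
  by (rule delta1_comprehension[of "lift p" "lift p" e s P]) (use assms in \<open>auto intro: Delta00_lift\<close>)

section \<open>Arithmetic and order in the model\<close>

lemma basic: "p \<in> basic_axioms \<Longrightarrow> sat e s p"
  by (rule ax) (simp add: RCA0_def)

lemma succ_neq_zero [simp]: "x \<oplus> \<one> \<noteq> \<zero>"
  using basic[of "\<^bold>\<not> (Var 1 \<^bold>+ \<^bold>1 \<^bold>= \<^bold>0)" "\<lambda>_. x"] by (simp add: basic_axioms_def Let_def)

lemma zero_neq_succ [simp]: "\<zero> \<noteq> x \<oplus> \<one>"
  using succ_neq_zero[of x] by metis

lemma succ_inject [simp]: "x \<oplus> \<one> = y \<oplus> \<one> \<longleftrightarrow> x = y"
  using basic[of "Var 0 \<^bold>+ \<^bold>1 \<^bold>= Var 1 \<^bold>+ \<^bold>1 \<^bold>\<longrightarrow> Var 0 \<^bold>= Var 1" "x ## (\<lambda>_. y)"]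
  by (auto simp: basic_axioms_def Let_def)

lemma add_zero [simp]: "x \<oplus> \<zero> = x"
  using basic[of "Var 0 \<^bold>+ \<^bold>0 \<^bold>= Var 0" "\<lambda>_. x"] by (simp add: basic_axioms_def Let_def)

lemma add_succ: "x \<oplus> (y \<oplus> \<one>) = (x \<oplus> y) \<oplus> \<one>"
  using basic[of "Var 0 \<^bold>+ (Var 1 \<^bold>+ \<^bold>1) \<^bold>= (Var 0 \<^bold>+ Var 1) \<^bold>+ \<^bold>1" "x ## (\<lambda>_. y)"]
  by (simp add: basic_axioms_def Let_def)

lemma mul_zero [simp]: "x \<otimes> \<zero> = \<zero>"
  using basic[of "Var 0 \<^bold>* \<^bold>0 \<^bold>= \<^bold>0" "\<lambda>_. x"] by (simp add: basic_axioms_def Let_def)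

lemma mul_succ: "x \<otimes> (y \<oplus> \<one>) = x \<otimes> y \<oplus> x"
  using basic[of "Var 0 \<^bold>* (Var 1 \<^bold>+ \<^bold>1) \<^bold>= (Var 0 \<^bold>* Var 1) \<^bold>+ Var 0" "x ## (\<lambda>_. y)"]
  by (simp add: basic_axioms_def Let_def)

lemma not_less_zero [simp]: "\<not> x \<prec> \<zero>"
  using basic[of "\<^bold>\<not> (Var 0 \<^bold>< \<^bold>0)" "\<lambda>_. x"] by (simp add: basic_axioms_def Let_def)

lemma less_succ: "x \<prec> y \<oplus> \<one> \<longleftrightarrow> x \<prec> y \<or> x = y"
  using basic[of "Var 0 \<^bold>< Var 1 \<^bold>+ \<^bold>1 \<^bold>\<longleftrightarrow> Var 0 \<^bold>< Var 1 \<^bold>\<or> Var 0 \<^bold>= Var 1" "x ## (\<lambda>_. y)"]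
  by (simp add: basic_axioms_def Let_def)

lemma zero_add [simp]: "\<zero> \<oplus> x = x"
  by (rule delta_induct[of "\<^bold>0 \<^bold>+ Var 0 \<^bold>= Var 0" "\<lambda>_. x" _ _ x])
     (auto intro: Delta00_intros simp: add_succ)

lemma add_assoc: "(x \<oplus> y) \<oplus> z = x \<oplus> (y \<oplus> z)"
  by (rule delta_induct[of "(Var 1 \<^bold>+ Var 2) \<^bold>+ Var 0 \<^bold>= Var 1 \<^bold>+ (Var 2 \<^bold>+ Var 0)" "x ## (\<lambda>_. y)" _ _ z])
     (auto intro: Delta00_intros simp: add_succ)

lemma succ_add: "(x \<oplus> \<one>) \<oplus> y = (x \<oplus> y) \<oplus> \<one>"
  by (rule delta_induct[of "(Var 1 \<^bold>+ \<^bold>1) \<^bold>+ Var 0 \<^bold>= (Var 1 \<^bold>+ Var 0) \<^bold>+ \<^bold>1" "\<lambda>_. x" _ _ y])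
     (auto intro: Delta00_intros simp: add_succ)

lemma add_comm: "x \<oplus> y = y \<oplus> x"
  by (rule delta_induct[of "Var 1 \<^bold>+ Var 0 \<^bold>= Var 0 \<^bold>+ Var 1" "\<lambda>_. x" _ _ y])
     (auto intro: Delta00_intros simp: add_succ succ_add)

lemma add_left_comm: "x \<oplus> (y \<oplus> z) = y \<oplus> (x \<oplus> z)"
  by (metis add_assoc add_comm)

lemmas add_ac = add_assoc add_comm add_left_comm

lemma add_right_cancel [simp]: "x \<oplus> z = y \<oplus> z \<longleftrightarrow> x = y"
  by (rule delta_induct[of "Var 1 \<^bold>+ Var 0 \<^bold>= Var 2 \<^bold>+ Var 0 \<^bold>\<longleftrightarrow> Var 1 \<^bold>= Var 2" "x ## (\<lambda>_. y)" _ _ z])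
     (auto intro: Delta00_intros simp: add_assoc[symmetric])

lemma add_left_cancel [simp]: "z \<oplus> x = z \<oplus> y \<longleftrightarrow> x = y"
  by (metis add_right_cancel add_comm)

lemma mul_one [simp]: "x \<otimes> \<one> = x"
  using mul_succ[of x \<zero>] by simp

lemma zero_mul [simp]: "\<zero> \<otimes> x = \<zero>"
  by (rule delta_induct[of "\<^bold>0 \<^bold>* Var 0 \<^bold>= \<^bold>0" "\<lambda>_. x" _ _ x])
     (auto intro: Delta00_intros simp: mul_succ)

lemma succ_mul: "(x \<oplus> \<one>) \<otimes> y = x \<otimes> y \<oplus> y"
  by (rule delta_induct[of "(Var 1 \<^bold>+ \<^bold>1) \<^bold>* Var 0 \<^bold>= Var 1 \<^bold>* Var 0 \<^bold>+ Var 0" "\<lambda>_. x" _ _ y])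
     (auto intro: Delta00_intros simp: mul_succ add_ac)

lemma mul_comm: "x \<otimes> y = y \<otimes> x"
  by (rule delta_induct[of "Var 1 \<^bold>* Var 0 \<^bold>= Var 0 \<^bold>* Var 1" "\<lambda>_. x" _ _ y])
     (auto intro: Delta00_intros simp: mul_succ succ_mul)

lemma distrib_left: "x \<otimes> (y \<oplus> z) = x \<otimes> y \<oplus> x \<otimes> z"
  by (rule delta_induct[of "Var 1 \<^bold>* (Var 2 \<^bold>+ Var 0) \<^bold>= Var 1 \<^bold>* Var 2 \<^bold>+ Var 1 \<^bold>* Var 0" "x ## (\<lambda>_. y)" _ _ z])
     (auto intro: Delta00_intros simp: mul_succ add_assoc[symmetric])

lemma distrib_right: "(y \<oplus> z) \<otimes> x = y \<otimes> x \<oplus> z \<otimes> x"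
  by (metis distrib_left mul_comm)

lemma mul_assoc: "(x \<otimes> y) \<otimes> z = x \<otimes> (y \<otimes> z)"
  by (rule delta_induct[of "(Var 1 \<^bold>* Var 2) \<^bold>* Var 0 \<^bold>= Var 1 \<^bold>* (Var 2 \<^bold>* Var 0)" "x ## (\<lambda>_. y)" _ _ z])
     (auto intro: Delta00_intros simp: mul_succ distrib_left)

lemma mul_left_comm: "x \<otimes> (y \<otimes> z) = y \<otimes> (x \<otimes> z)"
  by (metis mul_assoc mul_comm)

lemma one_mul [simp]: "\<one> \<otimes> x = x"
  by (simp add: mul_comm[of \<one>])

lemmas ring_simps = add_ac mul_assoc mul_comm mul_left_comm distrib_left distrib_right

lemma zero_or_succ: "x = \<zero> \<or> (\<exists>y. x = y \<oplus> \<one>)"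
  by (rule sigma_induct[of "Var 1 \<^bold>= \<^bold>0 \<^bold>\<or> Var 1 \<^bold>= Var 0 \<^bold>+ \<^bold>1" "\<lambda>_. x" _ _ x])
     (auto intro: Delta00_intros)

text \<open>The order is axiomatised only by its behaviour at zero and successors. This reduces it
  to addition, from which transitivity and irreflexivity are read off.\<close>

lemma less_iff: "x \<prec> y \<longleftrightarrow> (\<exists>d. y = x \<oplus> (d \<oplus> \<one>))"
proof
  assume "x \<prec> y"
  \<comment> \<open>The existential quantifier is pulled in front of the implication to give a
    \<Sigma>-formula for the induction.\<close>
  have "\<exists>d. x \<prec> y \<longrightarrow> y = x \<oplus> (d \<oplus> \<one>)"
  proof (rule sigma_induct[of "Var 2 \<^bold>< Var 1 \<^bold>\<longrightarrow> Var 1 \<^bold>= Var 2 \<^bold>+ (Var 0 \<^bold>+ \<^bold>1)" "\<lambda>_. x" _ _ y])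
    fix y assume "\<exists>d. x \<prec> y \<longrightarrow> y = x \<oplus> (d \<oplus> \<one>)"
    then consider d where "y = x \<oplus> (d \<oplus> \<one>)" | "\<not> x \<prec> y" by blast
    then show "\<exists>d. x \<prec> y \<oplus> \<one> \<longrightarrow> y \<oplus> \<one> = x \<oplus> (d \<oplus> \<one>)"
    proof cases
      case 1
      then have "y \<oplus> \<one> = x \<oplus> ((d \<oplus> \<one>) \<oplus> \<one>)" by (simp add: add_succ)
      then show ?thesis by blast
    next
      case 2
      then show ?thesis unfolding less_succ by (metis zero_add)
    qed
  qed (auto intro: Delta00_intros)
  then show "\<exists>d. y = x \<oplus> (d \<oplus> \<one>)" using \<open>x \<prec> y\<close> by blast
next
  have "x \<prec> x \<oplus> (d \<oplus> \<one>)" for d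
    by (rule delta_induct[of "Var 1 \<^bold>< Var 1 \<^bold>+ (Var 0 \<^bold>+ \<^bold>1)" "\<lambda>_. x" _ _ d])
       (auto intro: Delta00_intros simp: less_succ add_succ)
  then show "\<exists>d. y = x \<oplus> (d \<oplus> \<one>) \<Longrightarrow> x \<prec> y" by blast
qed

lemma less_irrefl [simp]: "\<not> x \<prec> x"
proof
  assume "x \<prec> x"
  then obtain d where "x \<oplus> \<zero> = x \<oplus> (d \<oplus> \<one>)" using less_iff[of x x] by auto
  then show False unfolding add_left_cancel by simp
qed

lemma less_trans: "x \<prec> y \<Longrightarrow> y \<prec> z \<Longrightarrow> x \<prec> z"
  unfolding less_iff by (metis add_assoc)

lemma less_linear: "x \<prec> y \<or> x = y \<or> y \<prec> x"
proof -
  have pos: "\<zero> = y \<or> \<zero> \<prec> y" for y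
    using zero_or_succ[of y] less_iff[of \<zero> y] by auto
  have succ: "y \<prec> x \<Longrightarrow> x = y \<oplus> \<one> \<or> y \<oplus> \<one> \<prec> x" for y
    unfolding less_iff by (metis zero_or_succ zero_add add_assoc add_comm)
  show ?thesis
    by (rule delta_induct[of "Var 1 \<^bold>< Var 0 \<^bold>\<or> Var 1 \<^bold>= Var 0 \<^bold>\<or> Var 0 \<^bold>< Var 1" "\<lambda>_. x" _ _ y])
       (use pos[of x] succ in \<open>auto intro: Delta00_intros simp: less_succ\<close>)
qed

sublocale linorder "\<lambda>x y. x \<prec> y \<or> x = y" "(\<prec>)"
  by unfold_locales (use less_irrefl less_trans less_linear in blast)+

lemma less_addI: "x \<prec> x \<oplus> y \<oplus> \<one>" "y \<prec> x \<oplus> y \<oplus> \<one>"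
  unfolding less_iff by (metis add_assoc, metis add_assoc add_comm)

text \<open>Contracts two unbounded quantifiers into one that bounds both variables, as the schemes
  allow just one in front of a bounded matrix. The bound \<open>x + y + 1\<close> works.\<close>

lemma ex_pair_bounded: "(\<exists>z x y. x \<prec> z \<and> y \<prec> z \<and> P x y) \<longleftrightarrow> (\<exists>x y. P x y)"
  using less_addI by blast

lemma all_pair_bounded: "(\<forall>z x y. x \<prec> z \<longrightarrow> y \<prec> z \<longrightarrow> P x y) \<longleftrightarrow> (\<forall>x y. P x y)"
  using less_addI by blast


subsection \<open>Coding finite sets\<close>

definition divides (infix "divides" 50) where
  "x divides y \<longleftrightarrow> (\<exists>q. y = q \<otimes> x)"

lemma divides_mult: "x divides y \<Longrightarrow> x divides z \<otimes> y"
  unfolding divides_def by (metis mul_assoc)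

text \<open>There is no subtraction, so the quotients are compared instead: their difference is the
  quotient sought, and in the opposite order \<open>z\<close> must be zero.\<close>

lemma divides_add_cancel:
  assumes "x divides y" and "x divides y \<oplus> z"
  shows "x divides z"
proof -
  obtain u v where u: "y = u \<otimes> x" and v: "y \<oplus> z = v \<otimes> x" using assms unfolding divides_def by blast
  consider d where "v = u \<oplus> d" | d where "u = v \<oplus> d"
    using less_linear[of u v] unfolding less_iff by (metis add_zero)
  then show ?thesis
  proof cases
    case 1
    then have "y \<oplus> z = y \<oplus> d \<otimes> x" using u v by (simp add: distrib_right)
    then show ?thesis unfolding add_left_cancel divides_def by blast
  next
    case 2
    then have "v \<otimes> x \<oplus> (d \<otimes> x \<oplus> z) = v \<otimes> x \<oplus> \<zero>" using u v by (simp add: distrib_right add_assoc)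
    then have "d \<otimes> x \<oplus> z = \<zero>" unfolding add_left_cancel .
    then have "z = \<zero>" using zero_or_succ[of z] by (metis add_succ succ_neq_zero)
    then show ?thesis unfolding divides_def by (metis zero_mul)
  qed
qed

text \<open>Goedel's device: if every positive number below a bound divides \<open>m\<close>, then the moduli of
  distinct \<open>x\<close> are coprime, so a product of moduli codes the set of their indices.\<close>

abbreviation modulus where "modulus x m \<equiv> (x \<oplus> \<one>) \<otimes> m \<oplus> \<one>"

text \<open>The pair \<open>m\<close>, \<open>w\<close> stands for the set of these
  \<open>x\<close>. Only membership is coded, so divisibility replaces the remainders of the beta
  function.\<close>

definition coded where "coded x m w \<longleftrightarrow> modulus x m divides w"

text \<open>Modulo the modulus, \<open>(x + 1) m\<close> is \<open>-1\<close>, so \<open>m\<close>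
  is invertible.\<close>

lemma modulus_cancel:
  assumes "modulus x m divides w \<otimes> m"
  shows "modulus x m divides w"
proof -
  have "modulus x m divides (x \<oplus> \<one>) \<otimes> (w \<otimes> m)" using assms by (rule divides_mult)
  moreover have "(x \<oplus> \<one>) \<otimes> (w \<otimes> m) \<oplus> w = w \<otimes> modulus x m"
    by (simp add: ring_simps)
  moreover have "modulus x m divides w \<otimes> modulus x m" unfolding divides_def by blast
  ultimately show ?thesis by (metis divides_add_cancel)
qed

text \<open>The two moduli differ by \<open>(d + 1) m\<close>, where \<open>d + 1\<close> is the
  distance of \<open>x\<close> and \<open>y\<close>. So the modulus of \<open>x\<close> divides
  \<open>w (d + 1) m\<close>; cancel \<open>m\<close>, multiply up to \<open>w m\<close> using that
  \<open>d + 1\<close> divides \<open>m\<close>, and cancel again.\<close>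

lemma modulus_coprime:
  assumes div: "\<And>d. d \<prec> b \<Longrightarrow> d \<oplus> \<one> divides m" and "x \<prec> b" "y \<prec> b" "x \<noteq> y"
    and *: "modulus x m divides w \<otimes> modulus y m"
  shows "modulus x m divides w"
proof -
  have "\<exists>d. d \<prec> b \<and> modulus x m divides (w \<otimes> (d \<oplus> \<one>)) \<otimes> m"
    using less_linear[of x y]
  proof (elim disjE)
    assume "x \<prec> y"
    then obtain d where d: "y = x \<oplus> (d \<oplus> \<one>)" unfolding less_iff by blast
    have "w \<otimes> modulus y m = w \<otimes> modulus x m \<oplus> (w \<otimes> (d \<oplus> \<one>)) \<otimes> m"
      unfolding d by (simp add: ring_simps)
    moreover have "modulus x m divides w \<otimes> modulus x m" unfolding divides_def by blast
    ultimately have "modulus x m divides (w \<otimes> (d \<oplus> \<one>)) \<otimes> m" using * by (metis divides_add_cancel)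
    moreover have "d \<prec> b" using \<open>y \<prec> b\<close> less_addI(2)[of d x] less_trans by (metis d add_assoc)
    ultimately show ?thesis by blast
  next
    assume "y \<prec> x"
    then obtain d where d: "x = y \<oplus> (d \<oplus> \<one>)" unfolding less_iff by blast
    have "w \<otimes> modulus x m = w \<otimes> modulus y m \<oplus> (w \<otimes> (d \<oplus> \<one>)) \<otimes> m"
      unfolding d by (simp add: ring_simps)
    moreover have "modulus x m divides w \<otimes> modulus x m" unfolding divides_def by blast
    ultimately have "modulus x m divides (w \<otimes> (d \<oplus> \<one>)) \<otimes> m" using * by (metis divides_add_cancel)
    moreover have "d \<prec> b" using \<open>x \<prec> b\<close> less_addI(2)[of d y] less_trans by (metis d add_assoc)
    ultimately show ?thesis by blast
  qed (use \<open>x \<noteq> y\<close> in blast)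
  then obtain d where "d \<prec> b" and d: "modulus x m divides (w \<otimes> (d \<oplus> \<one>)) \<otimes> m" by blast
  from div[OF \<open>d \<prec> b\<close>] obtain k where k: "m = k \<otimes> (d \<oplus> \<one>)" unfolding divides_def by blast
  have "modulus x m divides k \<otimes> (w \<otimes> (d \<oplus> \<one>))" by (rule divides_mult) (rule modulus_cancel[OF d])
  also have "k \<otimes> (w \<otimes> (d \<oplus> \<one>)) = w \<otimes> m" unfolding k by (rule mul_left_comm)
  finally show ?thesis by (rule modulus_cancel)
qed

text \<open>For \<open>m\<close> nonzero every modulus exceeds one; for \<open>m\<close> zero it
  would be one and divide everything.\<close>

lemma not_coded_one: "m \<noteq> \<zero> \<Longrightarrow> \<not> coded x m \<one>"
proof
  assume "m \<noteq> \<zero>" and "coded x m \<one>"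
  then obtain q where q: "\<one> = q \<otimes> modulus x m" unfolding coded_def divides_def by blast
  obtain k where k: "m = k \<oplus> \<one>" using \<open>m \<noteq> \<zero>\<close> zero_or_succ by blast
  have "q \<noteq> \<zero>" using q succ_neq_zero[of \<zero>] by auto
  then obtain r where r: "q = r \<oplus> \<one>" using zero_or_succ by blast
  have "\<zero> \<oplus> \<one> = (r \<otimes> modulus x m \<oplus> (x \<otimes> m \<oplus> k \<oplus> \<one>)) \<oplus> \<one>"
    using q unfolding r by (simp add: distrib_right add_assoc k)
  then show False unfolding succ_inject by (metis add_assoc zero_neq_succ)
qed

text \<open>The quotient by a positive number is at most the dividend, which makes divisibility a
  bounded formula.\<close>

lemma divides_bounded: "x \<oplus> \<one> divides y \<longleftrightarrow> (\<exists>q. q \<prec> y \<oplus> \<one> \<and> y = q \<otimes> (x \<oplus> \<one>))"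
proof -
  have "q \<prec> q \<otimes> (x \<oplus> \<one>) \<oplus> \<one>" for q
    using less_addI(2)[of q "q \<otimes> x"] by (simp add: distrib_left)
  then show ?thesis unfolding divides_def by blast
qed

definition coded_fm :: "tm \<Rightarrow> tm \<Rightarrow> tm \<Rightarrow> fm" where
  "coded_fm x m w = ExB (w \<^bold>+ \<^bold>1)
    (lift_tm w \<^bold>= Var 0 \<^bold>* ((lift_tm x \<^bold>+ \<^bold>1) \<^bold>* lift_tm m \<^bold>+ \<^bold>1))"

lemma coded_fm_Delta00: "coded_fm x m w \<in> Delta00"
  unfolding coded_fm_def by (intro Delta00_intros)

lemma sat_coded_fm [simp]:
  "sat e s (coded_fm x m w) \<longleftrightarrow> coded (tmval e x) (tmval e m) (tmval e w)"
  by (simp add: coded_fm_def coded_def divides_bounded)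

text \<open>A substitute for the factorial: induction on the existence statement, multiplying by
  \<open>b + 1\<close> at each step, avoids defining a function by recursion.\<close>

lemma ex_common_multiple: "\<exists>m. m \<noteq> \<zero> \<and> (\<forall>x. x \<prec> b \<longrightarrow> x \<oplus> \<one> divides m)"
proof (rule sigma_induct[of "\<^bold>\<not> (Var 0 \<^bold>= \<^bold>0) \<^bold>\<and>
      AllB (Var 1) (ExB (Var 1 \<^bold>+ \<^bold>1) (Var 2 \<^bold>= Var 0 \<^bold>* (Var 1 \<^bold>+ \<^bold>1)))" _ _ _ b])
  show "\<exists>m. m \<noteq> \<zero> \<and> (\<forall>x. x \<prec> \<zero> \<longrightarrow> x \<oplus> \<one> divides m)"
    by (metis not_less_zero succ_neq_zero)
next
  fix b
  assume "\<exists>m. m \<noteq> \<zero> \<and> (\<forall>x. x \<prec> b \<longrightarrow> x \<oplus> \<one> divides m)"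
  then obtain m where m: "m \<noteq> \<zero>" "\<And>x. x \<prec> b \<Longrightarrow> x \<oplus> \<one> divides m" by blast
  have "m \<otimes> (b \<oplus> \<one>) \<noteq> \<zero>"
  proof -
    obtain k where "m = k \<oplus> \<one>" using m(1) zero_or_succ by blast
    then have "m \<otimes> (b \<oplus> \<one>) = (m \<otimes> b \<oplus> k) \<oplus> \<one>" by (simp add: distrib_left add_assoc)
    then show ?thesis by simp
  qed
  moreover have "x \<oplus> \<one> divides m \<otimes> (b \<oplus> \<one>)" if "x \<prec> b \<oplus> \<one>" for x
    using that m(2) unfolding less_succ by (metis divides_def divides_mult mul_comm)
  ultimately show "\<exists>m. m \<noteq> \<zero> \<and> (\<forall>x. x \<prec> b \<oplus> \<one> \<longrightarrow> x \<oplus> \<one> divides m)" by blast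
qed (auto intro!: Delta00_intros simp: divides_bounded)

text \<open>With \<open>m\<close> fixed for the bound \<open>b\<close>, induction on
  \<open>y\<close> codes the part of \<open>P\<close> below \<open>y\<close> by a product of
  moduli.\<close>

lemma ex_code:
  assumes p: "p \<in> Delta00" and P: "\<And>x. sat (x ## e) s p \<longleftrightarrow> P x"
  shows "\<exists>m w. \<forall>x. x \<prec> b \<longrightarrow> (coded x m w \<longleftrightarrow> P x)"
proof -
  obtain m where m0: "m \<noteq> \<zero>" and m: "\<And>x. x \<prec> b \<Longrightarrow> x \<oplus> \<one> divides m"
    using ex_common_multiple by blast
  \<comment> \<open>\<open>p\<close> is moved under \<open>w\<close>, \<open>y\<close>,
    \<open>m\<close> and \<open>b\<close>: index 0 remains the element, and the parameters start at
    index 5 instead of 1.\<close>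
  let ?q = "subst (case_nat (Var 0) (\<lambda>n. Var (n + 5))) p"
  have q: "sat (x ## w ## y ## m ## b ## e) s ?q \<longleftrightarrow> P x" for x w y
  proof -
    have "(\<lambda>n. tmval (x ## w ## y ## m ## b ## e) (case_nat (Var 0) (\<lambda>n. Var (n + 5)) n)) = x ## e"
      by (auto simp: numeral_eq_Suc split: nat.split)
    then show ?thesis by (simp add: sat_subst P)
  qed
  have "\<exists>w. \<forall>x. x \<prec> b \<longrightarrow> (coded x m w \<longleftrightarrow> x \<prec> y \<and> P x)" for y
  proof (rule sigma_induct[of "AllB (Var 3)
      (coded_fm (Var 0) (Var 3) (Var 1) \<^bold>\<longleftrightarrow> Var 0 \<^bold>< Var 2 \<^bold>\<and> ?q)" "m ## b ## e" s _ y])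
    show "\<exists>w. \<forall>x. x \<prec> b \<longrightarrow> (coded x m w \<longleftrightarrow> x \<prec> \<zero> \<and> P x)"
      \<comment> \<open>The empty product codes the empty set.\<close>
      using not_coded_one[OF m0] by auto
  next
    fix y assume "\<exists>w. \<forall>x. x \<prec> b \<longrightarrow> (coded x m w \<longleftrightarrow> x \<prec> y \<and> P x)"
    then obtain w where w: "\<And>x. x \<prec> b \<Longrightarrow> coded x m w \<longleftrightarrow> x \<prec> y \<and> P x" by blast
    show "\<exists>w. \<forall>x. x \<prec> b \<longrightarrow> (coded x m w \<longleftrightarrow> x \<prec> y \<oplus> \<one> \<and> P x)"
    proof (cases "y \<prec> b \<and> P y")
      case True
      \<comment> \<open>Multiplying by the modulus of \<open>y\<close> adds \<open>y\<close> to the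
        coded set; by coprimality the other indices below \<open>b\<close> are not affected.\<close>
      have "coded x m (w \<otimes> modulus y m) \<longleftrightarrow> x \<prec> y \<oplus> \<one> \<and> P x" if "x \<prec> b" for x
      proof (cases "x = y")
        case True
        then show ?thesis using \<open>y \<prec> b \<and> P y\<close> by (auto simp: coded_def divides_def less_succ)
      next
        case False
        have "coded x m (w \<otimes> modulus y m) \<longleftrightarrow> coded x m w"
          unfolding coded_def using modulus_coprime[OF m \<open>x \<prec> b\<close> _ False] True
          by (metis divides_mult mul_comm)
        then show ?thesis using w[OF that] False by (simp add: less_succ)
      qed
      then show ?thesis by blast
    next
      case False
      then show ?thesis using w by (intro exI[of _ w]) (auto simp: less_succ)
    qed
  qed (use p q in \<open>auto intro!: Delta00_intros coded_fm_Delta00 Delta00_subst simp del: sat_subst\<close>)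
  from this[of b] show ?thesis by blast
qed

subsection \<open>Greedy cliques\<close>

text \<open>Course-of-values induction: ordinary induction for the statement that \<open>P\<close>
  holds below \<open>z\<close>, which is again bounded.\<close>

lemma bounded_induct:
  assumes p: "p \<in> Delta00" and P: "\<And>x. sat (x ## e) s p \<longleftrightarrow> P x"
    and step: "\<And>x. (\<And>y. y \<prec> x \<Longrightarrow> P y) \<Longrightarrow> P x"
  shows "P x"
proof -
  let ?p = "subst (case_nat (Var 0) (\<lambda>n. Var (n + 2))) p"
  have sat: "sat (y ## x ## e) s ?p \<longleftrightarrow> P y" for x y
  proof -
    have "(\<lambda>n. tmval (y ## x ## e) (case_nat (Var 0) (\<lambda>n. Var (n + 2)) n)) = y ## e"
      by (auto simp: numeral_eq_Suc split: nat.split)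
    then show ?thesis by (simp only: sat_subst P)
  qed
  have "\<forall>y. y \<prec> z \<longrightarrow> P y" for z
    by (rule delta_induct[of "AllB (Var 0) ?p" e s _ z])
       (use sat p step in \<open>auto intro!: Delta00_intros Delta00_subst simp: less_succ\<close>)
  then show ?thesis using less_addI(1) by blast
qed

text \<open>Induction on the bound: either the new element \<open>b\<close> belongs to
  \<open>X\<close> and is the maximum, or the previous maximum stays.\<close>

lemma bounded_Max:
  assumes ex: "y \<in>\<in> X" and bound: "\<And>z. z \<in>\<in> X \<Longrightarrow> z \<prec> b"
  shows "\<exists>y. y \<in>\<in> X \<and> (\<forall>z. z \<in>\<in> X \<longrightarrow> \<not> y \<prec> z)"
proof -
  have "(\<exists>y. y \<prec> b \<and> y \<in>\<in> X) \<longrightarrow>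
      (\<exists>y. y \<prec> b \<and> y \<in>\<in> X \<and> (\<forall>z. z \<prec> b \<longrightarrow> z \<in>\<in> X \<longrightarrow> \<not> y \<prec> z))"
  proof (rule delta_induct[of "ExB (Var 0) (Var 0 \<^bold>\<in> 0) \<^bold>\<longrightarrow> ExB (Var 0) (Var 0 \<^bold>\<in> 0 \<^bold>\<and>
      AllB (Var 1) (Var 0 \<^bold>\<in> 0 \<^bold>\<longrightarrow> \<^bold>\<not> (Var 1 \<^bold>< Var 0)))" "\<lambda>_. \<zero>" "\<lambda>_. X" _ b])
    fix b
    assume IH: "(\<exists>y. y \<prec> b \<and> y \<in>\<in> X) \<longrightarrow>
      (\<exists>y. y \<prec> b \<and> y \<in>\<in> X \<and> (\<forall>z. z \<prec> b \<longrightarrow> z \<in>\<in> X \<longrightarrow> \<not> y \<prec> z))"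
    show "(\<exists>y. y \<prec> b \<oplus> \<one> \<and> y \<in>\<in> X) \<longrightarrow> (\<exists>y. y \<prec> b \<oplus> \<one> \<and> y \<in>\<in> X \<and>
      (\<forall>z. z \<prec> b \<oplus> \<one> \<longrightarrow> z \<in>\<in> X \<longrightarrow> \<not> y \<prec> z))"
    proof (cases "b \<in>\<in> X")
      case True
      then show ?thesis unfolding less_succ using less_trans less_irrefl by blast
    next
      case False
      then show ?thesis unfolding less_succ using IH by blast
    qed
  qed (auto intro!: Delta00_intros)
  then show ?thesis using ex bound by blast
qed

definition pairval where "pairval x y = (x \<oplus> y) \<otimes> (x \<oplus> y) \<oplus> x"

definition coloured where
  "coloured C i j s \<longleftrightarrow> pairval (pairval i j) s \<in>\<in> C"

lemma sat_colour [simp]: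
  "sat e s (colour C i j t) \<longleftrightarrow> coloured (s C) (tmval e i) (tmval e j) (tmval e t)"
  by (simp add: colour_def coloured_def pair_def pairval_def)

text \<open>The recursion of the greedy selection, imposed on a code and only below
  \<open>b\<close>, so that an initial segment of the clique is given by two numbers.\<close>

definition greedy where
  "greedy C X v b m w \<longleftrightarrow> (\<forall>x. x \<prec> b \<longrightarrow>
    (coded x m w \<longleftrightarrow> x \<in>\<in> X \<and> (\<forall>y. y \<prec> x \<longrightarrow> coded y m w \<longrightarrow> coloured C y x v)))"

text \<open>Set variable 0 is the colouring and set variable 1 the set the clique is selected from.\<close>

definition greedy_fm :: "tm \<Rightarrow> tm \<Rightarrow> tm \<Rightarrow> tm \<Rightarrow> fm" where
  "greedy_fm v b m w = AllB b (coded_fm (Var 0) (lift_tm m) (lift_tm w) \<^bold>\<longleftrightarrow>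
     Var 0 \<^bold>\<in> 1 \<^bold>\<and> AllB (Var 0) (coded_fm (Var 0) (lift_tm (lift_tm m)) (lift_tm (lift_tm w)) \<^bold>\<longrightarrow>
       colour 0 (Var 0) (Var 1) (lift_tm (lift_tm v))))"

lemma greedy_fm_Delta00: "greedy_fm v b m w \<in> Delta00"
  unfolding greedy_fm_def by (intro Delta00_intros coded_fm_Delta00)

lemma sat_greedy_fm [simp]: "sat e s (greedy_fm v b m w) \<longleftrightarrow>
    greedy (s 0) (s 1) (tmval e v) (tmval e b) (tmval e m) (tmval e w)"
  by (simp add: greedy_fm_def greedy_def)

text \<open>Different codes may describe the same segment, but the recursion determines membership
  from smaller elements, so course-of-values induction applies.\<close>

lemma greedy_unique:
  assumes g: "greedy C X v b m w" and g': "greedy C X v b' m' w'" and "x \<prec> b" "x \<prec> b'"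
  shows "coded x m w \<longleftrightarrow> coded x m' w'"
proof -
  have "x \<prec> b \<and> x \<prec> b' \<longrightarrow> (coded x m w \<longleftrightarrow> coded x m' w')"
  proof (rule bounded_induct[of "Var 0 \<^bold>< Var 1 \<^bold>\<and> Var 0 \<^bold>< Var 2 \<^bold>\<longrightarrow>
      (coded_fm (Var 0) (Var 3) (Var 4) \<^bold>\<longleftrightarrow> coded_fm (Var 0) (Var 5) (Var 6))"
      "b ## b' ## m ## w ## m' ## (\<lambda>_. w')" _ _ x])
    fix x
    assume IH: "\<And>y. y \<prec> x \<Longrightarrow> y \<prec> b \<and> y \<prec> b' \<longrightarrow> (coded y m w \<longleftrightarrow> coded y m' w')"
    show "x \<prec> b \<and> x \<prec> b' \<longrightarrow> (coded x m w \<longleftrightarrow> coded x m' w')"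
    proof
      assume x: "x \<prec> b \<and> x \<prec> b'"
      then have "coded y m w \<longleftrightarrow> coded y m' w'" if "y \<prec> x" for y
        using IH[OF that] that less_trans by blast
      then show "coded x m w \<longleftrightarrow> coded x m' w'" using x g g' unfolding greedy_def by blast
    qed
  qed (auto intro!: Delta00_intros coded_fm_Delta00)
  then show ?thesis using assms by blast
qed

text \<open>Induction on \<open>b\<close>, in which only membership of \<open>b\<close> itself is
  decided. A new code is taken at each step, since the codes supplied by \<open>ex_code\<close>
  depend on the bound.\<close>

lemma ex_greedy: "\<exists>m w. greedy C X v b m w"
proof (rule sigma_induct[of "ExB (Var 0) (ExB (Var 1)
      (greedy_fm (Var 4) (Var 3) (Var 1) (Var 0)))" "\<lambda>_. v" "C ## (\<lambda>_. X)" _ b])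
  show "\<exists>m w. greedy C X v \<zero> m w" by (simp add: greedy_def)
next
  fix b assume "\<exists>m w. greedy C X v b m w"
  then obtain m w where g: "greedy C X v b m w" by blast
  let ?P = "\<lambda>x. x \<prec> b \<and> coded x m w \<or> x = b \<and> b \<in>\<in> X \<and> (\<forall>y. y \<prec> b \<longrightarrow> coded y m w \<longrightarrow> coloured C y b v)"
  have "\<exists>m' w'. \<forall>x. x \<prec> b \<oplus> \<one> \<longrightarrow> (coded x m' w' \<longleftrightarrow> ?P x)"
    by (rule ex_code[of "Var 0 \<^bold>< Var 1 \<^bold>\<and> coded_fm (Var 0) (Var 2) (Var 3) \<^bold>\<or>
          Var 0 \<^bold>= Var 1 \<^bold>\<and> Var 1 \<^bold>\<in> 1 \<^bold>\<and>
          AllB (Var 1) (coded_fm (Var 0) (Var 3) (Var 4) \<^bold>\<longrightarrow> colour 0 (Var 0) (Var 2) (Var 5))"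
        "b ## m ## w ## (\<lambda>_. v)" "C ## (\<lambda>_. X)"])
       (auto intro!: Delta00_intros coded_fm_Delta00)
  then obtain m' w' where c: "\<And>x. x \<prec> b \<oplus> \<one> \<Longrightarrow> coded x m' w' \<longleftrightarrow> ?P x" by blast
  have "greedy C X v (b \<oplus> \<one>) m' w'"
    unfolding greedy_def
  proof (intro allI impI)
    fix x assume x: "x \<prec> b \<oplus> \<one>"
    have old: "coded y m' w' \<longleftrightarrow> coded y m w" if "y \<prec> b" for y
      using c[of y] that less_irrefl unfolding less_succ by blast
    show "coded x m' w' \<longleftrightarrow> x \<in>\<in> X \<and> (\<forall>y. y \<prec> x \<longrightarrow> coded y m' w' \<longrightarrow> coloured C y x v)"
    proof (cases "x = b")
      case True
      then show ?thesis using c[OF x] old by auto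
    next
      case False
      then have "x \<prec> b" using x less_succ by blast
      moreover have "y \<prec> x \<Longrightarrow> y \<prec> b" for y using \<open>x \<prec> b\<close> less_trans by blast
      ultimately show ?thesis using g old unfolding greedy_def by blast
    qed
  qed
  then show "\<exists>m w. greedy C X v (b \<oplus> \<one>) m w" by blast
qed (use ex_pair_bounded in \<open>auto intro!: Delta00_intros greedy_fm_Delta00\<close>)

text \<open>An element is selected iff some greedy code up to it contains it, equivalently iff every
  such code does. This is the pair of \<Sigma>- and \<Pi>-definitions that comprehension asks
  for.\<close>

lemma ex_greedy_clique:
  "\<exists>I. \<forall>x. x \<in>\<in> I \<longleftrightarrow> x \<in>\<in> X \<and> (\<forall>y. y \<prec> x \<longrightarrow> y \<in>\<in> I \<longrightarrow> coloured C y x v)"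
proof -
  let ?P = "\<lambda>x. \<exists>m w. greedy C X v (x \<oplus> \<one>) m w \<and> coded x m w"
  have P_iff: "?P x \<longleftrightarrow> coded x m w" if "greedy C X v b m w" "x \<prec> b" for x b m w
    using greedy_unique[OF that(1) _ that(2)] ex_greedy[of C X v "x \<oplus> \<one>"] less_succ by metis
  have "\<exists>I. \<forall>x. x \<in>\<in> I \<longleftrightarrow> ?P x"
  proof (rule delta1_comprehension[of
        "ExB (Var 0) (ExB (Var 1) (greedy_fm (Var 4) (Var 3 \<^bold>+ \<^bold>1) (Var 1) (Var 0) \<^bold>\<and>
          coded_fm (Var 3) (Var 1) (Var 0)))"
        "AllB (Var 0) (AllB (Var 1) (greedy_fm (Var 4) (Var 3 \<^bold>+ \<^bold>1) (Var 1) (Var 0) \<^bold>\<longrightarrow>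
          coded_fm (Var 3) (Var 1) (Var 0)))"
        "\<lambda>_. v" "C ## (\<lambda>_. X)" ?P])
    fix x
    \<comment> \<open>Uniqueness of greedy segments gives one direction, their existence the
      other.\<close>
    have "?P x \<longleftrightarrow> (\<forall>m w. greedy C X v (x \<oplus> \<one>) m w \<longrightarrow> coded x m w)"
    proof
      assume "?P x"
      then show "\<forall>m w. greedy C X v (x \<oplus> \<one>) m w \<longrightarrow> coded x m w"
        using P_iff[of "x \<oplus> \<one>" _ _ x] by (simp add: less_succ)
    next
      assume "\<forall>m w. greedy C X v (x \<oplus> \<one>) m w \<longrightarrow> coded x m w"
      then show "?P x" using ex_greedy[of C X v "x \<oplus> \<one>"] by auto
    qed
    then show "(\<forall>y. sat (y ## x ## (\<lambda>_. v)) (C ## (\<lambda>_. X)) (AllB (Var 0) (AllB (Var 1)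
        (greedy_fm (Var 4) (Var 3 \<^bold>+ \<^bold>1) (Var 1) (Var 0) \<^bold>\<longrightarrow> coded_fm (Var 3) (Var 1) (Var 0)))))
        \<longleftrightarrow> ?P x"
      using all_pair_bounded[of "\<lambda>m w. greedy C X v (x \<oplus> \<one>) m w \<longrightarrow> coded x m w"] by auto
  next
    fix x
    show "(\<exists>y. sat (y ## x ## (\<lambda>_. v)) (C ## (\<lambda>_. X)) (ExB (Var 0) (ExB (Var 1)
        (greedy_fm (Var 4) (Var 3 \<^bold>+ \<^bold>1) (Var 1) (Var 0) \<^bold>\<and> coded_fm (Var 3) (Var 1) (Var 0)))))
        \<longleftrightarrow> ?P x"
      using ex_pair_bounded[of "\<lambda>m w. greedy C X v (x \<oplus> \<one>) m w \<and> coded x m w"] by auto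
  qed (intro Delta00_intros greedy_fm_Delta00 coded_fm_Delta00)+
  then obtain I where I: "\<And>x. x \<in>\<in> I \<longleftrightarrow> ?P x" by blast
  have "x \<in>\<in> I \<longleftrightarrow> x \<in>\<in> X \<and> (\<forall>y. y \<prec> x \<longrightarrow> y \<in>\<in> I \<longrightarrow> coloured C y x v)" for x
  proof -
    obtain m w where g: "greedy C X v (x \<oplus> \<one>) m w" using ex_greedy by blast
    have "y \<in>\<in> I \<longleftrightarrow> coded y m w" if "y \<prec> x \<oplus> \<one>" for y
      unfolding I by (rule P_iff[OF g that])
    then show ?thesis using g unfolding greedy_def less_succ by blast
  qed
  then show ?thesis by blast
qed


subsection \<open>Externally finite colourings\<close>

text \<open>External induction on \<open>A\<close>, adding one parameter at a time.\<close>

lemma ex_finite_set: "finite A \<Longrightarrow> \<exists>X. \<forall>x. x \<in>\<in> X \<longleftrightarrow> x \<in> A"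
proof (induction A rule: finite_induct)
  case empty
  show ?case by (rule delta0_comprehension[of "\<^bold>\<bottom>"]) (auto intro: Delta00_intros)
next
  case (insert a A)
  then obtain X where "\<And>x. x \<in>\<in> X \<longleftrightarrow> x \<in> A" by blast
  then show ?case
    by (intro delta0_comprehension[of "Var 0 \<^bold>\<in> 0 \<^bold>\<or> Var 0 \<^bold>= Var 1" "\<lambda>_. a" "\<lambda>_. X"])
       (auto intro: Delta00_intros)
qed

lemma numval_inject [simp]: "numval m = numval n \<longleftrightarrow> m = n"
proof (induction m arbitrary: n)
  case 0
  then show ?case by (cases n) auto
next
  case (Suc m)
  then show ?case by (cases n) auto
qed

text \<open>Below a standard element there are only standard ones, so a quantifier bounded by the
  number of colours ranges over exactly the external colours.\<close>

lemma less_numval: "x \<prec> numval n \<longleftrightarrow> (\<exists>p<n. x = numval p)"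
  by (induction n) (auto simp: less_succ less_Suc_eq)

lemma add_succ_less: "x \<oplus> y \<oplus> \<one> \<prec> z \<Longrightarrow> x \<prec> z \<and> y \<prec> z"
  using less_trans[OF less_addI(1)] less_trans[OF less_addI(2)] by blast

lemma ex_upper_bound: "finite A \<Longrightarrow> \<exists>k. \<forall>a\<in>A. a \<prec> k"
proof (induction A rule: finite_induct)
  case (insert a A)
  then obtain k where "\<forall>b\<in>A. b \<prec> k" by blast
  then have "\<forall>b\<in>insert a A. b \<prec> a \<oplus> k \<oplus> \<one>"
    using less_addI(1)[of a k] less_trans[OF _ less_addI(2)[of k a]] by simp
  then show ?case ..
qed simp

text \<open>If every case were bounded, a common bound for the externally finitely many cases would
  contradict cofinality. \<open>P\<close> and \<open>Q\<close> are arbitrary external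
  predicates.\<close>

lemma pigeonhole_cofinal:
  assumes "finite A" and cof: "\<And>b. \<exists>i. b \<prec> i \<and> P i" and A: "\<And>i. P i \<Longrightarrow> \<exists>a\<in>A. Q a i"
  shows "\<exists>a\<in>A. \<forall>b. \<exists>i. b \<prec> i \<and> P i \<and> Q a i"
proof (rule ccontr)
  assume "\<not> ?thesis"
  then obtain b where b: "\<And>a i. a \<in> A \<Longrightarrow> b a \<prec> i \<Longrightarrow> P i \<Longrightarrow> \<not> Q a i" by metis
  obtain k where k: "\<forall>a\<in>b ` A. a \<prec> k" using ex_upper_bound \<open>finite A\<close> by blast
  obtain i where "k \<prec> i" "P i" using cof by blast
  then show False using A[of i] b k less_trans by blast
qed

text \<open>The colouring appears twice: \<open>c\<close> is an external function used for
  reasoning, and \<open>C\<close> is a set of the model used in formulas. The external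
  \<open>g\<close> multiplies colours.\<close>

lemma ex_clique:
  fixes c :: "'n \<Rightarrow> 'n \<Rightarrow> nat"
  assumes c_less: "\<And>i j. i \<prec> j \<Longrightarrow> c i j < n"
    and c_add: "\<And>i j k. i \<prec> j \<Longrightarrow> j \<prec> k \<Longrightarrow> c i k = g (c i j) (c j k)"
    and c_iff: "\<And>i j p. i \<prec> j \<Longrightarrow> p < n \<Longrightarrow> coloured C i j (numval p) \<longleftrightarrow> c i j = p"
  shows "\<exists>p<n. \<exists>I. (\<forall>b. \<exists>i. b \<prec> i \<and> i \<in>\<in> I) \<and>
    (\<forall>i j. i \<in>\<in> I \<and> j \<in>\<in> I \<and> i \<prec> j \<longrightarrow> coloured C i j (numval p))"
proof -
  define sim where "sim i j \<longleftrightarrow> (\<exists>k. i \<prec> k \<and> j \<prec> k \<and> c i k = c j k)" for i j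
  \<comment> \<open>By additivity both colours at \<open>k'\<close> are the same colour at
    \<open>k\<close> multiplied by \<open>c k k'\<close>.\<close>
  have persist: "c i k' = c j k'"
    if "i \<prec> k" "j \<prec> k" "c i k = c j k" "k \<prec> k' \<or> k = k'" for i j k k'
    using that c_add by metis
  have sim_sym: "sim i j \<Longrightarrow> sim j i" for i j unfolding sim_def by metis
  have sim_refl: "sim i i" for i unfolding sim_def using less_succ by metis
  have sim_trans: "sim i l" if ij: "sim i j" and jl: "sim j l" for i j l
  proof -
    obtain k1 where k1: "i \<prec> k1" "j \<prec> k1" "c i k1 = c j k1" using ij unfolding sim_def by blast
    obtain k2 where k2: "j \<prec> k2" "l \<prec> k2" "c j k2 = c l k2" using jl unfolding sim_def by blast
    define k where "k = k1 \<oplus> k2 \<oplus> \<one>"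
    have k: "k1 \<prec> k" "k2 \<prec> k" unfolding k_def by (rule less_addI)+
    then have "c i k = c l k" using persist[OF k1, of k] persist[OF k2, of k] by simp
    moreover have "i \<prec> k" "l \<prec> k" using k k1 k2 less_trans by blast+
    ultimately show ?thesis unfolding sim_def by blast
  qed
  define indep where "indep A \<longleftrightarrow> finite A \<and> (\<forall>a\<in>A. \<forall>b\<in>A. sim a b \<longrightarrow> a = b)" for A
  \<comment> \<open>Inequivalent elements get distinct colours at any \<open>k\<close> above all of
    them, and there are \<open>n\<close> colours.\<close>
  have card: "card A \<le> n" if "indep A" for A
  proof -
    obtain k where k: "\<forall>a\<in>A. a \<prec> k" using ex_upper_bound \<open>indep A\<close> unfolding indep_def by blast
    have "inj_on (\<lambda>a. c a k) A" using \<open>indep A\<close> k unfolding indep_def inj_on_def sim_def by metis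
    moreover have "(\<lambda>a. c a k) ` A \<subseteq> {..<n}" using c_less k by blast
    ultimately show ?thesis using card_inj_on_le[of "\<lambda>a. c a k" A "{..<n}"] by simp
  qed
  have "indep {}" unfolding indep_def by simp
  \<comment> \<open>An independent set of greatest size represents every class; \<open>Suc n\<close>
    appears because the bound has to be strict.\<close>
  then have "\<exists>A. indep A \<and> (\<forall>B. indep B \<longrightarrow> card B \<le> card A)"
    by (rule ex_has_greatest_nat[where b="Suc n"]) (use card in \<open>simp add: less_Suc_eq_le\<close>)
  then obtain A where A: "indep A" and max: "\<And>B. indep B \<Longrightarrow> card B \<le> card A" by blast
  have reps: "\<exists>r\<in>A. sim i r" for i
  proof (rule ccontr)
    assume *: "\<not> ?thesis"
    then have "i \<notin> A" using sim_refl by blast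
    moreover have "indep (insert i A)" using A * sim_sym unfolding indep_def by blast
    ultimately show False using max[of "insert i A"] A unfolding indep_def by simp
  qed
  have fin: "finite A" using A indep_def by blast
  \<comment> \<open>One of the finitely many classes is cofinal.\<close>
  have "\<exists>r\<in>A. \<forall>b. \<exists>i. b \<prec> i \<and> True \<and> sim i r"
    by (rule pigeonhole_cofinal[OF fin]) (use reps less_succ in blast)+
  then obtain r where r: "r \<in> A" "\<And>b. \<exists>i. b \<prec> i \<and> sim i r" by blast
  \<comment> \<open>Within that class a colour seen from \<open>r\<close> is cofinal. Requiring
    \<open>i\<close> above \<open>r\<close> keeps \<open>c r i\<close> meaningful.\<close>
  have "\<exists>p\<in>{..<n}. \<forall>b. \<exists>i. b \<prec> i \<and> (r \<prec> i \<and> sim i r) \<and> c r i = p"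
  proof (rule pigeonhole_cofinal)
    fix b
    show "\<exists>i. b \<prec> i \<and> r \<prec> i \<and> sim i r"
      using r(2)[of "b \<oplus> r \<oplus> \<one>"] add_succ_less[of b r] by blast
  qed (use c_less in auto)
  then obtain p where p: "p < n"
    and cof: "\<And>b. \<exists>i. b \<prec> i \<and> r \<prec> i \<and> sim i r \<and> c r i = p" by auto
  \<comment> \<open>The other representatives are made a set of the model, so that a formula can
    range over them.\<close>
  obtain A' where A': "\<And>x. x \<in>\<in> A' \<longleftrightarrow> x \<in> A - {r}"
    using ex_finite_set[of "A - {r}"] fin by blast
  let ?S = "C ## (\<lambda>_. A')" and ?E = "r ## numval p ## (\<lambda>_. numval n)"
  \<comment> \<open>The \<Sigma>-definition asks for a place where \<open>x\<close> and
    \<open>r\<close> receive the same colour. The \<Pi>-definition denies that \<open>x\<close> ever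
    agrees with another representative.\<close>
  have "\<exists>X. \<forall>x. x \<in>\<in> X \<longleftrightarrow> r \<prec> x \<and> c r x = p \<and> sim x r"
  proof (rule delta1_comprehension[of
        "(Var 2 \<^bold>< Var 1 \<^bold>\<and> colour 0 (Var 2) (Var 1) (Var 3)) \<^bold>\<and> Var 1 \<^bold>< Var 0 \<^bold>\<and>
          ExB (Var 4) (colour 0 (Var 2) (Var 1) (Var 0) \<^bold>\<and> colour 0 (Var 3) (Var 1) (Var 0))"
        "(Var 2 \<^bold>< Var 1 \<^bold>\<and> colour 0 (Var 2) (Var 1) (Var 3)) \<^bold>\<and> \<^bold>\<not> (Var 1 \<^bold>< Var 0 \<^bold>\<and>
          ExB (Var 0) (Var 0 \<^bold>\<in> 1 \<^bold>\<and>
            ExB (Var 5) (colour 0 (Var 3) (Var 2) (Var 0) \<^bold>\<and> colour 0 (Var 1) (Var 2) (Var 0))))"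
        ?E ?S])
    \<comment> \<open>Equality of two colours becomes a bounded formula by quantifying over the
      colour below \<open>n\<close>.\<close>
    have same: "(\<exists>q. q \<prec> numval n \<and> coloured C i k q \<and> coloured C j k q) \<longleftrightarrow> c i k = c j k"
      if "i \<prec> k" "j \<prec> k" for i j k
    proof
      assume "c i k = c j k"
      then show "\<exists>q. q \<prec> numval n \<and> coloured C i k q \<and> coloured C j k q"
        unfolding less_numval using that c_iff c_less[OF \<open>i \<prec> k\<close>] by metis
    qed (use that c_iff in \<open>auto simp: less_numval\<close>)
    have p_iff: "r \<prec> x \<and> coloured C r x (numval p) \<longleftrightarrow> r \<prec> x \<and> c r x = p" for x
      using c_iff p by blast
    fix x
    have 1: "(\<exists>y. (r \<prec> x \<and> coloured C r x (numval p)) \<and> x \<prec> y \<and>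
        (\<exists>q. q \<prec> numval n \<and> coloured C x y q \<and> coloured C r y q)) \<longleftrightarrow>
        r \<prec> x \<and> c r x = p \<and> sim x r"
    proof (cases "r \<prec> x")
      case True
      then have "(x \<prec> y \<and> (\<exists>q. q \<prec> numval n \<and> coloured C x y q \<and> coloured C r y q)) \<longleftrightarrow>
          (x \<prec> y \<and> r \<prec> y \<and> c x y = c r y)" for y
        using same less_trans by blast
      then show ?thesis unfolding sim_def p_iff by simp
    qed simp
    then show "(\<exists>y. sat (y ## x ## ?E) ?S
       ((Var 2 \<^bold>< Var 1 \<^bold>\<and> colour 0 (Var 2) (Var 1) (Var 3)) \<^bold>\<and> Var 1 \<^bold>< Var 0 \<^bold>\<and>
          ExB (Var 4) (colour 0 (Var 2) (Var 1) (Var 0) \<^bold>\<and> colour 0 (Var 3) (Var 1) (Var 0))))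
        \<longleftrightarrow> r \<prec> x \<and> c r x = p \<and> sim x r" by simp
    have not_sim: "\<not> (\<exists>y. x \<prec> y \<and> (\<exists>a. a \<prec> y \<and> a \<in> A - {r} \<and> c x y = c a y)) \<longleftrightarrow> sim x r"
    proof
      assume *: "\<not> (\<exists>y. x \<prec> y \<and> (\<exists>a. a \<prec> y \<and> a \<in> A - {r} \<and> c x y = c a y))"
      obtain a where "a \<in> A" "sim x a" using reps by blast
      then show "sim x r" using * unfolding sim_def by (cases "a = r") blast+
    next
      assume "sim x r"
      have False if "a \<in> A - {r}" "sim x a" for a
      proof -
        have "sim r a" using sim_trans sim_sym \<open>sim x r\<close> \<open>sim x a\<close> by blast
        then show False using A r(1) that(1) unfolding indep_def by blast
      qed
      then show "\<not> (\<exists>y. x \<prec> y \<and> (\<exists>a. a \<prec> y \<and> a \<in> A - {r} \<and> c x y = c a y))"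
        unfolding sim_def by blast
    qed
    have "(\<forall>y. (r \<prec> x \<and> coloured C r x (numval p)) \<and> \<not> (x \<prec> y \<and>
        (\<exists>a. a \<prec> y \<and> a \<in>\<in> A' \<and> (\<exists>q. q \<prec> numval n \<and> coloured C x y q \<and> coloured C a y q)))) \<longleftrightarrow>
        r \<prec> x \<and> c r x = p \<and> sim x r"
    proof -
      have "(x \<prec> y \<and> (\<exists>a. a \<prec> y \<and> a \<in> A - {r} \<and>
            (\<exists>q. q \<prec> numval n \<and> coloured C x y q \<and> coloured C a y q))) \<longleftrightarrow>
          (x \<prec> y \<and> (\<exists>a. a \<prec> y \<and> a \<in> A - {r} \<and> c x y = c a y))" for y
        using same by blast
      then show ?thesis unfolding not_sim[symmetric] A' p_iff by simp
    qed
    then show "(\<forall>y. sat (y ## x ## ?E) ?S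
       ((Var 2 \<^bold>< Var 1 \<^bold>\<and> colour 0 (Var 2) (Var 1) (Var 3)) \<^bold>\<and> \<^bold>\<not> (Var 1 \<^bold>< Var 0 \<^bold>\<and>
          ExB (Var 0) (Var 0 \<^bold>\<in> 1 \<^bold>\<and>
            ExB (Var 5) (colour 0 (Var 3) (Var 2) (Var 0) \<^bold>\<and> colour 0 (Var 1) (Var 2) (Var 0))))))
        \<longleftrightarrow> r \<prec> x \<and> c r x = p \<and> sim x r" by simp
  qed (intro Delta00_intros)+
  then obtain X where X: "\<And>x. x \<in>\<in> X \<longleftrightarrow> r \<prec> x \<and> c r x = p \<and> sim x r" by blast
  have extend: "\<exists>x. b \<prec> x \<and> x \<in>\<in> X \<and> y \<prec> x \<and> c y x = p" if "y \<in>\<in> X" for b y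
  proof -
    obtain k where k: "y \<prec> k" "r \<prec> k" "c y k = c r k" using \<open>y \<in>\<in> X\<close> unfolding X sim_def by blast
    \<comment> \<open>\<open>x\<close> is taken beyond \<open>k\<close>, where \<open>y\<close> and
      \<open>r\<close> have merged, so it has the same colour from both, namely
      \<open>p\<close>.\<close>
    obtain x where x: "b \<oplus> k \<oplus> \<one> \<prec> x" "x \<in>\<in> X" using cof unfolding X by blast
    have "b \<prec> x" "k \<prec> x" using add_succ_less[OF x(1)] by blast+
    moreover have "c y x = p" using persist[OF k, of x] \<open>k \<prec> x\<close> x(2) unfolding X by simp
    moreover have "y \<prec> x" using k(1) \<open>k \<prec> x\<close> less_trans by blast
    ultimately show ?thesis using x(2) by blast
  qed
  \<comment> \<open>Among \<open>r\<close>, \<open>y\<close> and \<open>x\<close> all three colours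
    are \<open>p\<close>, and additivity gives the equation.\<close>
  have idem: "g p p = p"
  proof -
    obtain y where y: "y \<in>\<in> X" using cof[of \<zero>] unfolding X by blast
    obtain x where x: "x \<in>\<in> X" "y \<prec> x" "c y x = p" using extend[OF y] by blast
    then show ?thesis using c_add[of r y x] y unfolding X by simp
  qed
  obtain I where I: "\<And>x. x \<in>\<in> I \<longleftrightarrow> x \<in>\<in> X \<and> (\<forall>y. y \<prec> x \<longrightarrow> y \<in>\<in> I \<longrightarrow> coloured C y x (numval p))"
    using ex_greedy_clique by blast
  have "\<exists>i. b \<prec> i \<and> i \<in>\<in> I" for b
  proof (rule ccontr)
    assume "\<not> ?thesis"
    then have bound: "\<not> b \<prec> i" if "i \<in>\<in> I" for i using that by blast
    \<comment> \<open>If nothing were selected, any element of \<open>X\<close> would satisfy the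
      greedy condition vacuously.\<close>
    have "\<exists>y. y \<in>\<in> I"
      using I cof X by metis
    moreover have "i \<prec> b \<oplus> \<one>" if "i \<in>\<in> I" for i
      using bound[OF that] less_linear less_succ by blast
    ultimately obtain y where y: "y \<in>\<in> I" "\<And>z. z \<in>\<in> I \<Longrightarrow> \<not> y \<prec> z"
      using bounded_Max by blast
    obtain x where x: "b \<prec> x" "x \<in>\<in> X" "y \<prec> x" "c y x = p" using extend[of y b] y(1) I by blast
    have "coloured C z x (numval p)" if "z \<prec> x" "z \<in>\<in> I" for z
    proof (cases "z = y")
      case False
      then have "z \<prec> y" using y(2)[OF \<open>z \<in>\<in> I\<close>] less_linear by blast
      then have "c z y = p" using y(1) I \<open>z \<in>\<in> I\<close> c_iff p by blast
      \<comment> \<open>The maximum \<open>y\<close> lies between \<open>z\<close> and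
        \<open>x\<close>, so the colour is the product of \<open>p\<close> with itself.\<close>
      then have "c z x = p" using c_add[OF \<open>z \<prec> y\<close> \<open>y \<prec> x\<close>] x idem by simp
      then show ?thesis using c_iff[OF \<open>z \<prec> x\<close> p] by simp
    qed (use x c_iff p in blast)
    then have "x \<in>\<in> I" using I x(2) by blast
    then show False using bound x(1) by blast
  qed
  moreover have "coloured C i j (numval p)" if "i \<in>\<in> I" "j \<in>\<in> I" "i \<prec> j" for i j
    using I that by blast
  ultimately show ?thesis using p by blast
qed

section \<open>From the formal sentence to colourings of the model\<close>

lemma sat_in_S [simp]: "sat e s (in_S xs t) \<longleftrightarrow> (\<exists>p<length xs. tmval e t = numval p)"
  by (auto simp: in_S_def)

lemma sat_additive_ramsey:
  fixes f :: "'a \<Rightarrow> 'a \<Rightarrow> 'a"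
  assumes xs: "set xs = UNIV"
  shows "sat e s (additive_ramsey f xs)"
proof -
  let ?n = "length xs"
  have "\<exists>x. (\<exists>p<?n. x = numval p) \<and> (\<exists>I. (\<forall>b. \<exists>i. b \<prec> i \<and> i \<in>\<in> I) \<and>
      (\<forall>i j. i \<in>\<in> I \<and> j \<in>\<in> I \<and> i \<prec> j \<longrightarrow> coloured C i j x))"
    if col: "sat e (C ## s) (is_colouring xs 0)" and add: "sat e (C ## s) (is_additive f xs 0)" for C
  proof -
    have ex: "\<exists>p<?n. coloured C i j (numval p)"
      and uniq: "p < ?n \<Longrightarrow> q < ?n \<Longrightarrow> coloured C i j (numval p) \<Longrightarrow> coloured C i j (numval q) \<Longrightarrow> p = q"
      if "i \<prec> j" for i j p q
    proof -
      have "\<exists>x. ((\<exists>p<?n. x = numval p) \<and> coloured C i j x) \<and>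
          (\<forall>y. (\<exists>p<?n. y = numval p) \<and> coloured C i j y \<longrightarrow> y = x)"
        using col that by (simp add: is_colouring_def Let_def numeral_eq_Suc)
      then show "\<exists>p<?n. coloured C i j (numval p)"
        and "p < ?n \<Longrightarrow> q < ?n \<Longrightarrow> coloured C i j (numval p) \<Longrightarrow> coloured C i j (numval q) \<Longrightarrow> p = q"
        by (auto, metis numval_inject)
    qed
    have mult: "coloured C i k (numval r)"
      if "i \<prec> j" "j \<prec> k" "p < ?n" "q < ?n" "r < ?n" "f (xs ! p) (xs ! q) = xs ! r"
        "coloured C i j (numval p)" "coloured C j k (numval q)" for i j k p q r
      using add that by (fastforce simp: is_additive_def Let_def numeral_eq_Suc)
    \<comment> \<open>Existence and uniqueness in the formal graph let each pair above the diagonal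
      be assigned its external colour.\<close>
    define c where "c i j = (SOME p. p < ?n \<and> coloured C i j (numval p))" for i j
    have c: "c i j < ?n" "coloured C i j (numval (c i j))" if "i \<prec> j" for i j
      using someI_ex[OF ex[OF that, unfolded Bex_def]] unfolding c_def by auto
    \<comment> \<open>Multiplication of positions in the enumeration; the product has a position
      because \<open>xs\<close> exhausts the type.\<close>
    define g where "g p q = (SOME r. r < ?n \<and> f (xs ! p) (xs ! q) = xs ! r)" for p q
    have g: "g p q < ?n" "f (xs ! p) (xs ! q) = xs ! g p q" for p q
    proof -
      have "f (xs ! p) (xs ! q) \<in> set xs" using xs by simp
      then have "\<exists>r. r < ?n \<and> f (xs ! p) (xs ! q) = xs ! r" by (metis in_set_conv_nth)
      from someI_ex[OF this] show "g p q < ?n" "f (xs ! p) (xs ! q) = xs ! g p q"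
        unfolding g_def by auto
    qed
    have "\<exists>p<?n. \<exists>I. (\<forall>b. \<exists>i. b \<prec> i \<and> i \<in>\<in> I) \<and>
      (\<forall>i j. i \<in>\<in> I \<and> j \<in>\<in> I \<and> i \<prec> j \<longrightarrow> coloured C i j (numval p))"
    proof (rule ex_clique[of c ?n g])
      fix i j k assume ij: "i \<prec> j" and jk: "j \<prec> k"
      then have ik: "i \<prec> k" using less_trans by blast
      have "coloured C i k (numval (g (c i j) (c j k)))"
        by (rule mult[OF ij jk c(1)[OF ij] c(1)[OF jk] g c(2)[OF ij] c(2)[OF jk]])
      then show "c i k = g (c i j) (c j k)" using uniq[OF ik] c[OF ik] g by blast
    next
      fix i j p assume "i \<prec> j" "p < ?n"
      then show "coloured C i j (numval p) \<longleftrightarrow> c i j = p" using uniq c by blast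
    qed (rule c)
    then show ?thesis by blast
  qed
  then show ?thesis
    by (simp add: additive_ramsey_def is_infinite_def is_clique_def Let_def)
qed

end

text \<open>Derived in the calculus from the two successor axioms by external induction; it supplies
  the infinitude of the term model in \<open>completeness\<close>.\<close>

lemma RCA0_numerals_distinct:
  assumes "m < n"
  shows "RCA0 \<turnstile> \<^bold>\<not> (num m \<^bold>= num n)"
  unfolding provable_def using assms
proof (induction m arbitrary: n)
  \<comment> \<open>With an empty context the eigenvariable condition is vacuous, so free variables
    of theorems can be instantiated.\<close>
  have gen: "RCA0 \<triangleright> [] \<turnstile> inst t p" if "RCA0 \<triangleright> [] \<turnstile> p" for p t
    by (rule nd.AllN_E[OF nd.AllN_I]) (simp add: that)
  \<comment> \<open>The inner instance fills variable 0, after which variable 1 has become 0 and is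
    filled by the outer one.\<close>
  have inst2: "RCA0 \<triangleright> [] \<turnstile> inst t (inst u p)" if "p \<in> basic_axioms" for p t u
    by (intro gen nd.Axiom) (simp add: RCA0_def that)
  have num: "subst_tm \<sigma> (num k) = num k" for \<sigma> k by (induction k) auto
  {
    case 0
    then obtain k where n: "n = Suc k" by (cases n) auto
    have "RCA0 \<triangleright> [] \<turnstile> \<^bold>\<not> (num k \<^bold>+ \<^bold>1 \<^bold>= \<^bold>0)"
      using inst2[of "\<^bold>\<not> (Var 1 \<^bold>+ \<^bold>1 \<^bold>= \<^bold>0)" "num k" "\<^bold>0"]
      by (simp add: basic_axioms_def Let_def inst_def Neg_def num)
    then have "RCA0 \<triangleright> [\<^bold>0 \<^bold>= num k \<^bold>+ \<^bold>1] \<turnstile> \<^bold>\<not> (num k \<^bold>+ \<^bold>1 \<^bold>= \<^bold>0)" by (rule nd_weaken) simp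
    moreover have "RCA0 \<triangleright> [\<^bold>0 \<^bold>= num k \<^bold>+ \<^bold>1] \<turnstile> num k \<^bold>+ \<^bold>1 \<^bold>= \<^bold>0"
      using nd.Eq_subst[of RCA0 "[\<^bold>0 \<^bold>= num k \<^bold>+ \<^bold>1]" "\<^bold>0" "num k \<^bold>+ \<^bold>1" "Var 0 \<^bold>= \<^bold>0"]
      by (simp add: inst_def nd.Hyp nd.Eq_refl)
    ultimately have "RCA0 \<triangleright> [\<^bold>0 \<^bold>= num k \<^bold>+ \<^bold>1] \<turnstile> \<^bold>\<bottom>" by (rule nd_Neg_E)
    then show ?case unfolding Neg_def n by (simp add: nd.Imp_I)
  next
    case (Suc m)
    then obtain k where n: "n = Suc k" and "m < k" by (cases n) auto
    let ?e = "num m \<^bold>+ \<^bold>1 \<^bold>= num k \<^bold>+ \<^bold>1"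
    have "RCA0 \<triangleright> [] \<turnstile> ?e \<^bold>\<longrightarrow> num m \<^bold>= num k"
      using inst2[of "Var 0 \<^bold>+ \<^bold>1 \<^bold>= Var 1 \<^bold>+ \<^bold>1 \<^bold>\<longrightarrow> Var 0 \<^bold>= Var 1" "num k" "num m"]
      by (simp add: basic_axioms_def Let_def inst_def num)
    then have "RCA0 \<triangleright> [?e] \<turnstile> ?e \<^bold>\<longrightarrow> num m \<^bold>= num k" by (rule nd_weaken) simp
    then have "RCA0 \<triangleright> [?e] \<turnstile> num m \<^bold>= num k" by (rule nd.Imp_E) (simp add: nd.Hyp)
    moreover have "RCA0 \<triangleright> [?e] \<turnstile> \<^bold>\<not> (num m \<^bold>= num k)"
      using Suc.IH[OF \<open>m < k\<close>] by (rule nd_weaken) simp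
    ultimately have "RCA0 \<triangleright> [?e] \<turnstile> \<^bold>\<bottom>" by (blast intro: nd_Neg_E)
    then show ?case unfolding Neg_def n by (simp add: nd.Imp_I)
  }
qed

theorem theoremB1:
  fixes f :: "'a::finite \<Rightarrow> 'a \<Rightarrow> 'a" and xs :: "'a list"
  assumes "semigroup f"
    and "distinct xs" and "set xs = UNIV"
  shows "RCA0 \<turnstile> additive_ramsey f xs"
proof (rule ccontr)
  assume "\<not> ?thesis"
  \<comment> \<open>Completeness turns unprovability into a countermodel, in which the combinatorial
    argument is carried out.\<close>
  then obtain zero one add mul less and mem :: "nat \<Rightarrow> nat \<Rightarrow> bool"
    where model: "\<forall>q\<in>RCA0. \<forall>e s. interp.sat (zero :: nat) one add mul less mem e s q"
      and counter: "\<exists>e s. \<not> interp.sat zero one add mul less mem e s (additive_ramsey f xs)"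
    using completeness[OF _ RCA0_numerals_distinct] by meson
  interpret rca_model zero one add mul less mem
    using model by unfold_locales blast
  show False using counter sat_additive_ramsey[OF \<open>set xs = UNIV\<close>] by blast
qed

end
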